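(* Let $F$ be a field and let $\Gamma\le \mathrm{GL}_d(F)$ be a finitely generated prime group with a Brenner element $b\in\Gamma$ (that is, an element $b$ having the Brenner property in $\Gamma$). Assume that: (1) $\Gamma$ has a finite center. (2) $\Gamma$ has a maximal finite normal subgroup $N$ (i.e., $N$ is a finite normal subgroup and any finite normal subgroup of $\Gamma$ is contained in $N$). (3) There exists $k$ such that the minimal number of generators of every finitely generated subgroup of $Z(C_\Gamma(b))$ is at most $k$. Then $\Gamma$ is first order rigid.
   Context: $Z(\cdot)$ denotes the center of a group and $C_\Gamma(g)$ the centralizer of $g$ in $\Gamma$. Two groups are elementarily equivalent if every first order sentence in the language of groups that holds in one also holds in the other. A finitely generated group $\Gamma$ is first order rigid if every finitely generated group elementarily equivalent to $\Gamma$ is isomorphic to $\Gamma$. A homomorphism $f:\Gamma\to\Lambda$ is an elementary embedding if for every first order formula $\phi(\vec{x})$ in the language of groups with $n$ free variables and every $\vec{a}\in\Gamma^n$, $\phi(\vec a)$ holds in $\Gamma$ if and only if $\phi(f(\vec a))$ holds in $\Lambda$. A group $\Gamma$ is prime if for every group $\Lambda$ elementarily equivalent to $\Gamma$ there is an elementary embedding $\Gamma\hookrightarrow\Lambda$. For $S\subset\Gamma$ and $n\ge1$, let $[S]^n=\{g_1\cdots g_n\mid g_i\in S\cup\{1\}\}$. Write $h^\Gamma$ for the conjugacy class of $h$ in $\Gamma$. An element $g\in\Gamma$ has the Brenner property if there exists a constant $D\ge1$ such that for every $h\in\Gamma$: if $|[h^\Gamma\cup(h^{-1})^\Gamma]^D|>D$,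 then $[h^\Gamma\cup(h^{-1})^\Gamma]^D\cap Z(C_\Gamma(g))\ne\{1\}$. *)

theory Defs
  imports "HOL-Algebra.Generated_Groups" "Jordan_Normal_Form.Matrix"
begin

datatype grp_term =
    TVar nat
  | TOne
  | TMult grp_term grp_term
  | TInv grp_term

datatype grp_formula =
    FEq grp_term grp_term
  | FNot grp_formula
  | FAnd grp_formula grp_formula
  | FEx nat grp_formula

primrec term_vars :: "grp_term \<Rightarrow> nat set" where
  "term_vars (TVar i) = {i}"
| "term_vars TOne = {}"
| "term_vars (TMult s t) = term_vars s \<union> term_vars t"
| "term_vars (TInv t) = term_vars t"

primrec free_vars :: "grp_formula \<Rightarrow> nat set" where
  "free_vars (FEq s t) = term_vars s \<union> term_vars t"
| "free_vars (FNot p) = free_vars p"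
| "free_vars (FAnd p q) = free_vars p \<union> free_vars q"
| "free_vars (FEx i p) = free_vars p - {i}"

primrec term_val :: "('a, 'm) monoid_scheme \<Rightarrow> (nat \<Rightarrow> 'a) \<Rightarrow> grp_term \<Rightarrow> 'a" where
  "term_val G e (TVar i) = e i"
| "term_val G e TOne = \<one>\<^bsub>G\<^esub>"
| "term_val G e (TMult s t) = term_val G e s \<otimes>\<^bsub>G\<^esub> term_val G e t"
| "term_val G e (TInv t) = inv\<^bsub>G\<^esub> (term_val G e t)"

primrec sat :: "('a, 'm) monoid_scheme \<Rightarrow> (nat \<Rightarrow> 'a) \<Rightarrow> grp_formula \<Rightarrow> bool" where
  "sat G e (FEq s t) \<longleftrightarrow> term_val G e s = term_val G e t"
| "sat G e (FNot p) \<longleftrightarrow> \<not> sat G e p"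
| "sat G e (FAnd p q) \<longleftrightarrow> sat G e p \<and> sat G e q"
| "sat G e (FEx i p) \<longleftrightarrow> (\<exists>x\<in>carrier G. sat G (e(i := x)) p)"

text \<open>For a sentence the value of \<open>sat\<close> does not depend on the assignment.\<close>

definition holds :: "('a, 'm) monoid_scheme \<Rightarrow> grp_formula \<Rightarrow> bool" where
  "holds G p \<longleftrightarrow> (\<forall>e. range e \<subseteq> carrier G \<longrightarrow> sat G e p)"

definition elem_equiv :: "('a, 'm) monoid_scheme \<Rightarrow> ('b, 'k) monoid_scheme \<Rightarrow> bool" where
  "elem_equiv G H \<longleftrightarrow> (\<forall>p. free_vars p = {} \<longrightarrow> (holds G p \<longleftrightarrow> holds H p))"

text \<open>Parameter tuples are given by assignments of all variables: a tuple extends to an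
  assignment, and a formula sees only the values at its finitely many free variables.\<close>

definition elem_embedding ::
    "('a, 'm) monoid_scheme \<Rightarrow> ('b, 'k) monoid_scheme \<Rightarrow> ('a \<Rightarrow> 'b) \<Rightarrow> bool" where
  "elem_embedding G H f \<longleftrightarrow>
     f \<in> hom G H \<and>
     (\<forall>p e. range e \<subseteq> carrier G \<longrightarrow> (sat G e p \<longleftrightarrow> sat H (f \<circ> e) p))"

definition fin_gen :: "('a, 'm) monoid_scheme \<Rightarrow> bool" where
  "fin_gen G \<longleftrightarrow> (\<exists>S\<subseteq>carrier G. finite S \<and> generate G S = carrier G)"

text \<open>Only meaningful when \<open>fin_gen G\<close> holds.\<close>

definition min_gens :: "('a, 'm) monoid_scheme \<Rightarrow> nat" where
  "min_gens G = (LEAST n. \<exists>S\<subseteq>carrier G. finite S \<and> card S = n \<and> generate G S = carrier G)"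

text \<open>HOL cannot quantify over types inside a formula, so the type over which the groups
  \<open>\<Lambda>\<close> range is a parameter of the next two definitions. For both notions
  \<open>nat\<close> is sufficient: every finitely generated group is countable,
  hence isomorphic to one whose carrier is a set of natural numbers, and for a
  countable \<open>G\<close> the downward Loewenheim-Skolem theorem reduces primeness to countable
  \<open>\<Lambda>\<close>.\<close>

definition first_order_rigid :: "'b itself \<Rightarrow> ('a, 'm) monoid_scheme \<Rightarrow> bool" where
  "first_order_rigid _ G \<longleftrightarrow>
     (\<forall>\<Lambda> :: 'b monoid. group \<Lambda> \<and> fin_gen \<Lambda> \<and> elem_equiv \<Lambda> G \<longrightarrow> \<Lambda> \<cong> G)"

definition prime_group :: "'b itself \<Rightarrow> ('a, 'm) monoid_scheme \<Rightarrow> bool" where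
  "prime_group _ G \<longleftrightarrow>
     (\<forall>\<Lambda> :: 'b monoid. group \<Lambda> \<and> elem_equiv \<Lambda> G \<longrightarrow> (\<exists>f. elem_embedding G \<Lambda> f))"

definition center :: "('a, 'm) monoid_scheme \<Rightarrow> 'a set" where
  "center G = {z \<in> carrier G. \<forall>x\<in>carrier G. z \<otimes>\<^bsub>G\<^esub> x = x \<otimes>\<^bsub>G\<^esub> z}"

definition centralizer :: "('a, 'm) monoid_scheme \<Rightarrow> 'a \<Rightarrow> 'a set" where
  "centralizer G g = {x \<in> carrier G. x \<otimes>\<^bsub>G\<^esub> g = g \<otimes>\<^bsub>G\<^esub> x}"

definition center_centralizer :: "('a, 'm) monoid_scheme \<Rightarrow> 'a \<Rightarrow> 'a set" where
  "center_centralizer G g = center (G\<lparr>carrier := centralizer G g\<rparr>)"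

definition conj_class :: "('a, 'm) monoid_scheme \<Rightarrow> 'a \<Rightarrow> 'a set" where
  "conj_class G h = {x \<otimes>\<^bsub>G\<^esub> h \<otimes>\<^bsub>G\<^esub> inv\<^bsub>G\<^esub> x | x. x \<in> carrier G}"

text \<open>The elements \<open>g\<^sub>1 \<cdots> g\<^sub>n\<close> with all \<open>g\<^sub>i \<in> S \<union> {1}\<close>, written \<open>[S]\<^sup>n\<close> in the literature.\<close>

definition prod_ball :: "('a, 'm) monoid_scheme \<Rightarrow> 'a set \<Rightarrow> nat \<Rightarrow> 'a set" where
  "prod_ball G S n =
     {foldr (\<otimes>\<^bsub>G\<^esub>) gs \<one>\<^bsub>G\<^esub> | gs. length gs = n \<and> set gs \<subseteq> S \<union> {\<one>\<^bsub>G\<^esub>}}"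

text \<open>The disjunct \<open>infinite B\<close> is needed because \<open>card B = 0\<close> for infinite \<open>B\<close>.\<close>

definition brenner :: "('a, 'm) monoid_scheme \<Rightarrow> 'a \<Rightarrow> bool" where
  "brenner G g \<longleftrightarrow>
     g \<in> carrier G \<and>
     (\<exists>D\<ge>1. \<forall>h\<in>carrier G.
        let B = prod_ball G (conj_class G h \<union> conj_class G (inv\<^bsub>G\<^esub> h)) D
        in infinite B \<or> card B > D \<longrightarrow> B \<inter> center_centralizer G g \<noteq> {\<one>\<^bsub>G\<^esub>})"

definition GL :: "'f::field itself \<Rightarrow> nat \<Rightarrow> 'f mat monoid" where
  "GL _ d = units_of (ring_mat TYPE('f) d ())"

end

theory Submission
  imports Defs "HOL-Computational_Algebra.Polynomial" "HOL-Library.Function_Algebras"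
    "HOL-Library.Countable_Set"
begin

text \<open>Let \<open>\<Lambda>\<close> be finitely generated and elementarily equivalent to \<open>\<Gamma>\<close>; by primeness \<open>\<Gamma>\<close> is an
  elementary subgroup of \<open>\<Lambda>\<close>. Linear groups are equationally Noetherian (Hilbert's basis theorem),
  so the relations of \<open>\<Lambda>\<close> amount in \<open>\<Gamma>\<close> to finitely many equations, and solving these in \<open>\<Gamma>\<close>
  yields for every \<open>h \<noteq> 1\<close> in \<open>\<Lambda>\<close> a retraction \<open>\<Lambda> \<rightarrow> \<Gamma>\<close> that does not kill \<open>h\<close>.
  Suppose that some retraction \<open>\<rho>\<close> has a kernel element \<open>h \<noteq> 1\<close>. In \<open>\<Gamma>\<close> every element outside the
  finite subgroup \<open>N\<close> has a large ball \<open>[h\<^sup>\<Gamma> \<union> (h\<inverse>)\<^sup>\<Gamma>]\<^sup>D\<close>, because a small one is a finite normal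
  subgroup. Hence the Brenner property carries over to \<open>\<Lambda>\<close> in first-order form and produces
  \<open>z \<noteq> 1\<close> in the intersection of the kernel with \<open>Z(C\<^sub>\<Lambda>(b))\<close>. The rank condition makes
  \<open>A = Z(C\<^sub>\<Gamma>(b))\<close> finite modulo \<open>n\<close>-th powers with representatives in \<open>\<Gamma>\<close>; this passes to \<open>\<Lambda>\<close>
  and forces \<open>z\<close> to be an \<open>n\<close>-th power for every \<open>n > 0\<close>. A second retraction maps \<open>z\<close> to a nontrivial element
  of \<open>\<Gamma>\<close> with the same property, against the residual finiteness of finitely generated linear
  groups (Malcev). So \<open>\<rho>\<close> is injective and \<open>\<Lambda> = \<Gamma>\<close>.\<close>

section \<open>Hilbert's basis theorem\<close>

text \<open>The rank bound quantifies over subgroups and has no evident first-order form. What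
  transfers is a consequence for one fixed \<open>n\<close>: finitely many representatives of
  \<open>Z(C(b))\<close> modulo \<open>n\<close>-th powers, named as parameters. Writing
  \<open>z = f a * q ^ n\<close> in \<Lambda> and applying the first retraction
  \<open>\<rho>\<close> gives \<open>a = (\<rho> q) ^ (- n)\<close>; as \<open>q\<close> commutes
  with \<open>f (\<rho> q)\<close>, the representative is absorbed into the power. The exponent is
  fixed only after a second retraction has moved \<open>z\<close> into \<Gamma>, because it depends
  on the image of \<open>z\<close>. The size of balls is treated likewise: it is never measured in
  \<Lambda>. The members of \<open>N\<close> are named as parameters, and every other element is
  asserted to satisfy the Brenner conclusion. On the algebraic side, the basis theorem is applied to
  rings of functions, where zero divisors may occur. Malcev's theorem comes from ideals of finite
  index in finitely generated subrings of the field, reached from the prime subring through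
  transcendental and then algebraic elements.\<close>

definition subring_set :: "'a::comm_ring_1 set \<Rightarrow> bool" where
  "subring_set R \<longleftrightarrow> 1 \<in> R \<and> (\<forall>x\<in>R. \<forall>y\<in>R. x - y \<in> R \<and> x * y \<in> R)"

lemma subring_setD:
  assumes "subring_set R"
  shows "0 \<in> R" "1 \<in> R" "x \<in> R \<Longrightarrow> - x \<in> R"
    "x \<in> R \<Longrightarrow> y \<in> R \<Longrightarrow> x + y \<in> R"
    "x \<in> R \<Longrightarrow> y \<in> R \<Longrightarrow> x - y \<in> R"
    "x \<in> R \<Longrightarrow> y \<in> R \<Longrightarrow> x * y \<in> R"
proof -
  have d: "\<And>x y. x \<in> R \<Longrightarrow> y \<in> R \<Longrightarrow> x - y \<in> R" and one: "1 \<in> R"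
    using assms by (auto simp: subring_set_def)
  have z: "0 \<in> R" using d[OF one one] by simp
  have m: "\<And>x. x \<in> R \<Longrightarrow> - x \<in> R" using d[OF z] by simp
  show "0 \<in> R" "1 \<in> R" "x \<in> R \<Longrightarrow> - x \<in> R" by (fact z one m)+
  show "x \<in> R \<Longrightarrow> y \<in> R \<Longrightarrow> x + y \<in> R" using d[OF _ m, of x y] by simp
  show "x \<in> R \<Longrightarrow> y \<in> R \<Longrightarrow> x - y \<in> R" by (fact d)
  show "x \<in> R \<Longrightarrow> y \<in> R \<Longrightarrow> x * y \<in> R" using assms by (auto simp: subring_set_def)
qed

lemma subring_set_sum:
  assumes "subring_set R" "\<And>i. i \<in> I \<Longrightarrow> f i \<in> R"
  shows "sum f I \<in> R"
  using assms(2) by (induction I rule: infinite_finite_induct) (auto simp: subring_setD[OF assms(1)])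

lemma subring_set_power: "subring_set R \<Longrightarrow> x \<in> R \<Longrightarrow> x ^ n \<in> R"
  by (induction n) (auto simp: subring_setD)

text \<open>Coefficients come from the set \<open>R\<close>, so that a chain of rings can live
  inside one type. Adding one multiple at a time replaces finite sums by induction.\<close>

inductive_set ideal_span :: "'a::comm_ring_1 set \<Rightarrow> 'a set \<Rightarrow> 'a set" for R A where
  ideal_span_zero: "0 \<in> ideal_span R A"
| ideal_span_step: "y \<in> ideal_span R A \<Longrightarrow> r \<in> R \<Longrightarrow> a \<in> A \<Longrightarrow> r * a + y \<in> ideal_span R A"

lemma ideal_span_base: "subring_set R \<Longrightarrow> a \<in> A \<Longrightarrow> a \<in> ideal_span R A"
  using ideal_span_step[OF ideal_span_zero, of 1 R a A] by (auto simp: subring_setD)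

lemma ideal_span_add: "x \<in> ideal_span R A \<Longrightarrow> y \<in> ideal_span R A \<Longrightarrow> x + y \<in> ideal_span R A"
  by (induction rule: ideal_span.induct) (auto simp: add.assoc intro: ideal_span_step)

lemma ideal_span_mult:
  assumes "subring_set R" "x \<in> ideal_span R A" "r \<in> R"
  shows "r * x \<in> ideal_span R A"
  using assms(2,1,3)
proof (induction rule: ideal_span.induct)
  case ideal_span_zero
  then show ?case by (simp add: ideal_span.ideal_span_zero)
next
  case (ideal_span_step y s a)
  then show ?case
    using ideal_span.ideal_span_step[of "r * y" R A "r * s" a] by (auto simp: algebra_simps subring_setD)
qed

lemma ideal_span_idem:
  assumes "subring_set R" "B \<subseteq> ideal_span R A"
  shows "ideal_span R B \<subseteq> ideal_span R A"
proof
  fix x assume "x \<in> ideal_span R B"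
  then show "x \<in> ideal_span R A"
    by induction (use assms in \<open>auto intro!: ideal_span_add ideal_span_mult simp: ideal_span.ideal_span_zero\<close>)
qed

lemma ideal_span_mono: "A \<subseteq> B \<Longrightarrow> ideal_span R A \<subseteq> ideal_span R B"
proof
  fix x assume "A \<subseteq> B" "x \<in> ideal_span R A"
  from this(2,1) show "x \<in> ideal_span R B"
    by induction (auto intro: ideal_span.intros)
qed

lemma ideal_span_finite:
  assumes "x \<in> ideal_span R (range f)"
  shows "\<exists>n::nat. x \<in> ideal_span R (f ` {..<n})"
  using assms
proof induction
  case (ideal_span_step y r a)
  then obtain n m where n: "y \<in> ideal_span R (f ` {..<n})" and m: "a = f m" by auto
  have "f ` {..<n} \<subseteq> f ` {..<max n (Suc m)}" by auto
  then have "y \<in> ideal_span R (f ` {..<max n (Suc m)})" using n ideal_span_mono by blast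
  then have "r * a + y \<in> ideal_span R (f ` {..<max n (Suc m)})"
    using ideal_span_step(2) m by (intro ideal_span.ideal_span_step) auto
  then show ?case by blast
qed (auto intro: ideal_span.ideal_span_zero)

text \<open>Equivalent to finite generation of all ideals: every sequence has a member in the ideal
  generated by its predecessors.\<close>

definition noetherian :: "'a::comm_ring_1 set \<Rightarrow> bool" where
  "noetherian R \<longleftrightarrow> (\<forall>f::nat \<Rightarrow> 'a. range f \<subseteq> R \<longrightarrow> (\<exists>n. f n \<in> ideal_span R (f ` {..<n})))"

definition polys_over :: "'a::comm_ring_1 set \<Rightarrow> 'a poly set" where
  "polys_over R = {p. range (coeff p) \<subseteq> R}"

lemma polys_overD: "p \<in> polys_over R \<Longrightarrow> coeff p i \<in> R"
  by (auto simp: polys_over_def)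

lemma subring_set_polys_over:
  assumes "subring_set R"
  shows "subring_set (polys_over R)"
  unfolding subring_set_def polys_over_def
  by (auto simp: coeff_mult coeff_1 subring_setD[OF assms] intro!: subring_set_sum[OF assms] subring_setD[OF assms])

lemma polys_over_pCons:
  assumes "a \<in> R" "p \<in> polys_over R"
  shows "pCons a p \<in> polys_over R"
  using assms by (auto simp: polys_over_def image_subset_iff coeff_pCons split: nat.splits)

lemma polys_over_monom: "subring_set R \<Longrightarrow> a \<in> R \<Longrightarrow> monom a n \<in> polys_over R"
  by (auto simp: polys_over_def subring_setD)

definition adjoin :: "'a::comm_ring_1 set \<Rightarrow> 'a \<Rightarrow> 'a set" where
  "adjoin R x = (\<lambda>p. poly p x) ` polys_over R"

lemma subring_set_adjoin:
  assumes "subring_set R"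
  shows "subring_set (adjoin R x)"
  unfolding subring_set_def adjoin_def
proof (intro conjI ballI)
  note s = subring_setD[OF subring_set_polys_over[OF assms]]
  show "1 \<in> (\<lambda>p. poly p x) ` polys_over R" using s(2) by (intro image_eqI[of _ _ 1]) auto
  fix y z assume "y \<in> (\<lambda>p. poly p x) ` polys_over R" "z \<in> (\<lambda>p. poly p x) ` polys_over R"
  then obtain p q where "p \<in> polys_over R" "q \<in> polys_over R" "y = poly p x" "z = poly q x" by auto
  then show "y - z \<in> (\<lambda>p. poly p x) ` polys_over R" "y * z \<in> (\<lambda>p. poly p x) ` polys_over R"
    using s(5,6) by (intro image_eqI[of _ _ "p - q"] image_eqI[of _ _ "p * q"]; simp)+
qed

text \<open>Choosing polynomials of minimal degree outside the ideal generated by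
  the previous ones, a relation between the leading coefficients lowers the degree. The polynomials
  need not be determined by their values at \<open>x\<close>.\<close>

lemma noetherian_adjoin:
  assumes R: "subring_set R" "noetherian R"
  shows "noetherian (adjoin R x)"
  unfolding noetherian_def
proof (intro allI impI, rule ccontr)
  let ?S = "adjoin R x"
  note S = subring_set_adjoin[OF R(1), of x]
  fix f :: "nat \<Rightarrow> 'a"
  assume f: "range f \<subseteq> ?S" and nf: "\<nexists>n. f n \<in> ideal_span ?S (f ` {..<n})"
  define I where "I = ideal_span ?S (range f)"
  define val where "val p = poly p x" for p
  \<comment> \<open>The bad sequence shows that no finite \<open>B\<close> inside \<open>I\<close>
    spans \<open>I\<close>: such a \<open>B\<close> lies in the span of an initial segment of
    \<open>f\<close>, and the next value of \<open>f\<close> escapes it.\<close>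
  have notfg: "\<exists>p\<in>polys_over R. val p \<in> I \<and> val p \<notin> ideal_span ?S B" if "finite B" "B \<subseteq> I" for B
  proof -
    have "\<exists>n. B \<subseteq> ideal_span ?S (f ` {..<n})"
      using that
    proof (induction B)
      case (insert b B)
      then obtain n m where nm: "B \<subseteq> ideal_span ?S (f ` {..<n})" "b \<in> ideal_span ?S (f ` {..<m})"
        using ideal_span_finite[of b ?S f] by (auto simp: I_def)
      have "insert b B \<subseteq> ideal_span ?S (f ` {..<max n m})"
        using nm ideal_span_mono[of "f ` {..<n}" "f ` {..<max n m}" ?S]
          ideal_span_mono[of "f ` {..<m}" "f ` {..<max n m}" ?S] by fastforce
      then show ?case by blast
    qed auto
    then obtain n where "B \<subseteq> ideal_span ?S (f ` {..<n})" by blast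
    from ideal_span_idem[OF S this] nf have "f n \<notin> ideal_span ?S B" by blast
    moreover have "f n \<in> I" unfolding I_def by (intro ideal_span_base S) auto
    moreover obtain p where "p \<in> polys_over R" "f n = val p" using f by (auto simp: adjoin_def val_def)
    ultimately show ?thesis by auto
  qed
  define Q where "Q B p \<longleftrightarrow> p \<in> polys_over R \<and> val p \<in> I \<and> val p \<notin> ideal_span ?S B" for B p
  define P where "P p n q \<longleftrightarrow> Q ((\<lambda>i. val (p i)) ` {..<n}) q \<and>
     (\<forall>q'. Q ((\<lambda>i. val (p i)) ` {..<n}) q' \<longrightarrow> degree q \<le> degree q')"
    for p :: "nat \<Rightarrow> 'a poly" and n :: nat and q
  have "\<exists>p. \<forall>n. P p n (p n)"
  \<comment> \<open>Course-of-values choice: the condition on \<open>p n\<close> involves only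
    earlier values of \<open>p\<close>, as the first obligation checks.\<close>
  proof (rule dependent_wellorder_choice)
    fix r and p g :: "nat \<Rightarrow> 'a poly" and n :: nat
    assume "\<And>m. m < n \<Longrightarrow> p m = g m"
    then have "(\<lambda>i. val (p i)) ` {..<n} = (\<lambda>i. val (g i)) ` {..<n}" by (intro image_cong) auto
    then show "P p n r = P g n r" by (simp add: P_def)
  next
    fix n and p :: "nat \<Rightarrow> 'a poly"
    assume IH: "\<And>m. m < n \<Longrightarrow> P p m (p m)"
    let ?B = "(\<lambda>i. val (p i)) ` {..<n}"
    have "?B \<subseteq> I" using IH by (auto simp: P_def Q_def)
    then have "\<exists>q. Q ?B q" using notfg[of ?B] by (auto simp: Q_def)
    then have "\<exists>q. Q ?B q \<and> (\<forall>q'. Q ?B q' \<longrightarrow> degree q \<le> degree q')"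
      using exists_least_iff[of "\<lambda>d. \<exists>q. Q ?B q \<and> degree q = d"] by (metis not_le)
    then show "\<exists>r. P p n r" by (simp add: P_def)
  qed
  then obtain p where p: "P p n (p n)" for n by blast
  \<comment> \<open>A larger span excludes more candidates, so the minimal degrees do not
    decrease.\<close>
  have deg: "degree (p i) \<le> degree (p n)" if "i \<le> n" for i n
  proof -
    have "ideal_span ?S ((\<lambda>i. val (p i)) ` {..<i}) \<subseteq> ideal_span ?S ((\<lambda>i. val (p i)) ` {..<n})"
      using that by (intro ideal_span_mono) auto
    then show ?thesis using p[of i] p[of n] unfolding P_def Q_def by blast
  qed
  have pR: "p n \<in> polys_over R" and pI: "val (p n) \<in> I" for n using p[of n] by (auto simp: P_def Q_def)
  have "range (\<lambda>i. lead_coeff (p i)) \<subseteq> R" using polys_overD[OF pR] by auto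
  from R(2)[unfolded noetherian_def, rule_format, OF this]
  obtain n where n: "lead_coeff (p n) \<in> ideal_span R ((\<lambda>i. lead_coeff (p i)) ` {..<n})" ..
  let ?B = "(\<lambda>i. val (p i)) ` {..<n}" and ?N = "degree (p n)"
  \<comment> \<open>Multiplying \<open>p i\<close> by a monomial moves its leading coefficient to
    position \<open>?N\<close>, so every combination of leading coefficients occurs there.\<close>
  have "\<exists>q\<in>polys_over R. val q \<in> ideal_span ?S ?B \<and> degree q \<le> ?N \<and> coeff q ?N = y"
    if "y \<in> ideal_span R ((\<lambda>i. lead_coeff (p i)) ` {..<n})" for y
    using that
  proof induction
    case ideal_span_zero
    show ?case
      by (rule bexI[of _ 0]) (auto simp: val_def ideal_span.ideal_span_zero subring_setD[OF subring_set_polys_over[OF R(1)]])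
  next
    case (ideal_span_step y r a)
    then obtain q i where q: "q \<in> polys_over R" "val q \<in> ideal_span ?S ?B" "degree q \<le> ?N" "coeff q ?N = y"
      and i: "i < n" "a = lead_coeff (p i)" by auto
    have d: "degree (p i) \<le> ?N" using deg i by simp
    define m where "m = monom r (?N - degree (p i))"
    have m: "m \<in> polys_over R" unfolding m_def using ideal_span_step(2) R(1) by (rule polys_over_monom[rotated])
    have "degree (m * p i) \<le> ?N"
      using degree_mult_le[of m "p i"] degree_monom_le[of r "?N - degree (p i)"] d
      by (simp add: m_def)
    moreover have "coeff (m * p i) ?N = r * a"
      using d by (simp add: m_def coeff_monom_mult i(2))
    moreover have "val (m * p i + q) \<in> ideal_span ?S ?B"
      using q(2) m i(1) by (auto simp: val_def adjoin_def intro!: ideal_span.ideal_span_step)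
    moreover have "m * p i + q \<in> polys_over R"
      using m q(1) pR by (intro subring_setD[OF subring_set_polys_over[OF R(1)]])
    ultimately show ?case using q(3,4)
      by (intro bexI[of _ "m * p i + q"]) (auto intro: degree_add_le)
  qed
  from this[OF n] obtain q where q: "q \<in> polys_over R" "val q \<in> ideal_span ?S ?B" "degree q \<le> ?N"
    "coeff q ?N = lead_coeff (p n)" by auto
  define g where "g = p n - q"
  have "?B \<subseteq> I" using pI by auto
  then have qI: "val q \<in> I" using ideal_span_idem[OF S, of ?B "range f"] q(2) by (auto simp: I_def)
  have neg: "- val q \<in> ideal_span ?S A" if "val q \<in> ideal_span ?S A" for A
    using ideal_span_mult[OF S that, of "- 1"] subring_setD[OF S] by simp
  have "val g \<in> I"
    using ideal_span_add[OF pI[of n, unfolded I_def] neg[OF qI[unfolded I_def]]] by (simp add: g_def val_def I_def)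
  moreover have "val g \<notin> ideal_span ?S ?B"
  proof
    assume "val g \<in> ideal_span ?S ?B"
    from ideal_span_add[OF this q(2)] show False using p[of n] by (simp add: g_def val_def P_def Q_def)
  qed
  moreover have "g \<in> polys_over R"
    unfolding g_def using pR q(1) by (intro subring_setD[OF subring_set_polys_over[OF R(1)]])
  \<comment> \<open>\<open>g\<close> competes with \<open>p n\<close>, has degree at most
    \<open>?N\<close> and coefficient zero at \<open>?N\<close>. Minimality leaves only
    \<open>g = 0\<close>, whose value lies in every span.\<close>
  ultimately have Qg: "Q ?B g" by (simp add: Q_def)
  then have "?N \<le> degree g" using p[of n] by (simp add: P_def)
  moreover have "degree g \<le> ?N" unfolding g_def using q(3) by (intro degree_diff_le) auto
  moreover have "coeff g ?N = 0" using q(4) by (simp add: g_def)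
  ultimately have "g = 0" by (metis le_antisym leading_coeff_0_iff)
  then show False using Qg ideal_span.ideal_span_zero[of ?S ?B] by (simp add: Q_def val_def)
qed

text \<open>Otherwise members of \<open>A\<close> could be picked forever, each outside the span of
  the earlier ones. That \<open>B\<close> is taken from \<open>A\<close> itself is what later yields
  a finite subsystem of equations.\<close>

lemma noetherian_finite_basis:
  assumes "subring_set R" "noetherian R" "A \<subseteq> R"
  shows "\<exists>B\<subseteq>A. finite B \<and> A \<subseteq> ideal_span R B"
proof (rule ccontr)
  assume contra: "\<not> ?thesis"
  define P where "P f n r \<longleftrightarrow> r \<in> A \<and> r \<notin> ideal_span R (f ` {..<n})" for f :: "nat \<Rightarrow> 'a" and n r
  have "\<exists>f. \<forall>n. P f n (f n)"
  proof (rule dependent_wellorder_choice)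
    fix r and f g :: "nat \<Rightarrow> 'a" and n :: nat
    assume "\<And>m. m < n \<Longrightarrow> f m = g m"
    then have "f ` {..<n} = g ` {..<n}" by (intro image_cong) auto
    then show "P f n r = P g n r" by (simp add: P_def)
  next
    fix n and f :: "nat \<Rightarrow> 'a"
    assume "\<And>m. m < n \<Longrightarrow> P f m (f m)"
    then have "f ` {..<n} \<subseteq> A" by (auto simp: P_def)
    then show "\<exists>r. P f n r" using contra unfolding P_def by blast
  qed
  then obtain f where f: "\<And>n. P f n (f n)" by blast
  then have "range f \<subseteq> R" using assms(3) by (auto simp: P_def)
  from assms(2)[unfolded noetherian_def, rule_format, OF this] show False using f by (auto simp: P_def)
qed

section \<open>Finite quotients of finitely generated domains\<close>

inductive_set ring_span :: "'a::comm_ring_1 set \<Rightarrow> 'a set" for X where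
  ring_span_one: "1 \<in> ring_span X"
| ring_span_base: "x \<in> X \<Longrightarrow> x \<in> ring_span X"
| ring_span_diff: "x \<in> ring_span X \<Longrightarrow> y \<in> ring_span X \<Longrightarrow> x - y \<in> ring_span X"
| ring_span_mult: "x \<in> ring_span X \<Longrightarrow> y \<in> ring_span X \<Longrightarrow> x * y \<in> ring_span X"

lemma subring_set_ring_span: "subring_set (ring_span X)"
  by (auto simp: subring_set_def intro: ring_span.intros)

lemma ring_span_least: "subring_set R \<Longrightarrow> X \<subseteq> R \<Longrightarrow> ring_span X \<subseteq> R"
proof
  fix x assume "x \<in> ring_span X" "subring_set R" "X \<subseteq> R"
  then show "x \<in> R" by induction (auto simp: subring_setD)
qed

lemma ring_span_mono: "X \<subseteq> Y \<Longrightarrow> ring_span X \<subseteq> ring_span Y"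
  by (rule ring_span_least[OF subring_set_ring_span]) (auto intro: ring_span_base)

lemma poly_in_subring_set:
  assumes "subring_set S" "p \<in> polys_over S" "x \<in> S"
  shows "poly p x \<in> S"
  unfolding poly_altdef using assms
  by (intro subring_set_sum subring_setD(6) polys_overD subring_set_power)

lemma polys_over_mono: "R \<subseteq> S \<Longrightarrow> polys_over R \<subseteq> polys_over S"
  by (auto simp: polys_over_def)

lemma adjoin_superset:
  assumes "subring_set R"
  shows "R \<subseteq> adjoin R x" "x \<in> adjoin R x"
proof
  note z = subring_setD(1)[OF subring_set_polys_over[OF assms]]
  fix r assume "r \<in> R"
  then have "[:r:] \<in> polys_over R" by (intro polys_over_pCons z)
  then show "r \<in> adjoin R x" unfolding adjoin_def by (rule rev_image_eqI) simp
next
  have "[:0, 1:] \<in> polys_over R"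
    by (intro polys_over_pCons subring_setD(1)[OF subring_set_polys_over[OF assms]] subring_setD[OF assms])
  then show "x \<in> adjoin R x" unfolding adjoin_def by (rule rev_image_eqI) simp
qed

text \<open>Lets finite generating sets be treated one generator at a time, for Noetherianity and
  for maximal ideals alike.\<close>

lemma adjoin_ring_span: "adjoin (ring_span X) x = ring_span (insert x X)"
proof
  show "adjoin (ring_span X) x \<subseteq> ring_span (insert x X)"
  proof
    fix y assume "y \<in> adjoin (ring_span X) x"
    then obtain p where "p \<in> polys_over (ring_span X)" and y: "y = poly p x" by (auto simp: adjoin_def)
    have "p \<in> polys_over (ring_span (insert x X))"
      using polys_over_mono[OF ring_span_mono[of X "insert x X"]] \<open>p \<in> polys_over (ring_span X)\<close> by blast
    then show "y \<in> ring_span (insert x X)"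
      unfolding y by (rule poly_in_subring_set[OF subring_set_ring_span]) (simp add: ring_span_base)
  qed
  show "ring_span (insert x X) \<subseteq> adjoin (ring_span X) x"
    using adjoin_superset[OF subring_set_ring_span[of X], where x = x]
    by (intro ring_span_least subring_set_adjoin subring_set_ring_span) (auto intro: ring_span_base)
qed

section \<open>Ideals of finite index and maximal ideals with finite residue field\<close>

definition ideal_set :: "'a::comm_ring_1 set \<Rightarrow> 'a set \<Rightarrow> bool" where
  "ideal_set R J \<longleftrightarrow> J \<subseteq> R \<and> 0 \<in> J \<and> (\<forall>x\<in>J. \<forall>y\<in>J. x + y \<in> J) \<and> (\<forall>r\<in>R. \<forall>x\<in>J. r * x \<in> J)"

lemma ideal_setD:
  assumes "subring_set R" "ideal_set R J"
  shows "x \<in> J \<Longrightarrow> x \<in> R" "0 \<in> J" "x \<in> J \<Longrightarrow> y \<in> J \<Longrightarrow> x + y \<in> J"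
    "r \<in> R \<Longrightarrow> x \<in> J \<Longrightarrow> r * x \<in> J" "r \<in> R \<Longrightarrow> x \<in> J \<Longrightarrow> x * r \<in> J"
    "x \<in> J \<Longrightarrow> - x \<in> J" "x \<in> J \<Longrightarrow> y \<in> J \<Longrightarrow> x - y \<in> J"
proof -
  have neg: "- x \<in> J" if "x \<in> J" for x
  proof -
    have "- 1 * x \<in> J" using assms that subring_setD(2,3)[OF assms(1)] unfolding ideal_set_def by blast
    then show ?thesis by simp
  qed
  show "x \<in> J \<Longrightarrow> x \<in> R" "0 \<in> J" and add: "\<And>y. x \<in> J \<Longrightarrow> y \<in> J \<Longrightarrow> x + y \<in> J"
    and m: "r \<in> R \<Longrightarrow> x \<in> J \<Longrightarrow> r * x \<in> J"
    using assms by (auto simp: ideal_set_def)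
  show "r \<in> R \<Longrightarrow> x \<in> J \<Longrightarrow> x * r \<in> J" using m by (simp add: mult.commute)
  show "x \<in> J \<Longrightarrow> - x \<in> J" by (rule neg)
  show "x \<in> J \<Longrightarrow> y \<in> J \<Longrightarrow> x - y \<in> J" using add[of "- y"] neg[of y] by simp
qed

lemma ideal_set_sum:
  assumes "subring_set R" "ideal_set R J" "\<And>i. i \<in> I \<Longrightarrow> f i \<in> J"
  shows "sum f I \<in> J"
  using assms(3) by (induction I rule: infinite_finite_induct) (auto simp: ideal_setD[OF assms(1,2)])

text \<open>Finiteness of \<open>R / J\<close>, phrased through representatives so that no quotient
  ring is formed.\<close>

definition finite_index :: "'a::comm_ring_1 set \<Rightarrow> 'a set \<Rightarrow> bool" where
  "finite_index R J \<longleftrightarrow> (\<exists>T\<subseteq>R. finite T \<and> (\<forall>r\<in>R. \<exists>t\<in>T. r - t \<in> J))"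

text \<open>The kernels of homomorphisms onto finite fields: the last clause is invertibility modulo
  \<open>m\<close>.\<close>

definition finite_maximal :: "'a::comm_ring_1 set \<Rightarrow> 'a set \<Rightarrow> bool" where
  "finite_maximal R m \<longleftrightarrow> ideal_set R m \<and> 1 \<notin> m \<and> finite_index R m \<and> (\<forall>r\<in>R - m. \<exists>s\<in>R. r * s - 1 \<in> m)"

lemma finite_maximal_prime:
  assumes "subring_set R" "finite_maximal R m" "r \<in> R" "s \<in> R" "r * s \<in> m"
  shows "r \<in> m \<or> s \<in> m"
proof (rule ccontr)
  assume n: "\<not> ?thesis"
  note i = ideal_setD[OF assms(1), of m]
  have im: "ideal_set R m" using assms(2) by (simp add: finite_maximal_def)
  obtain u where u: "u \<in> R" "r * u - 1 \<in> m" using n assms by (auto simp: finite_maximal_def)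
  from i(7)[OF im i(4)[OF im u(1) assms(5)] i(4)[OF im assms(4) u(2)]]
  show False using n by (simp add: algebra_simps)
qed

text \<open>An ideal containing \<open>J\<close> is determined by the representatives in
  \<open>T\<close> that it contains. Maximizing \<open>card (M \<inter> T)\<close> therefore
  replaces Zorn's lemma: adding \<open>r\<close> to \<open>M\<close> gains no representative, so the
  one of \<open>r\<close> is already in \<open>M\<close>, and with it \<open>r\<close>.\<close>

lemma finite_maximal_extend:
  assumes S: "subring_set S" and J: "ideal_set S J" "1 \<notin> J" "finite_index S J"
  shows "\<exists>M. finite_maximal S M \<and> J \<subseteq> M"
proof -
  obtain T where T: "T \<subseteq> S" "finite T" "\<And>r. r \<in> S \<Longrightarrow> \<exists>t\<in>T. r - t \<in> J"
    using J(3) by (auto simp: finite_index_def)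
  define P where "P M \<longleftrightarrow> ideal_set S M \<and> J \<subseteq> M \<and> 1 \<notin> M" for M
  have "\<exists>M. P M \<and> (\<forall>M'. P M' \<longrightarrow> card (M' \<inter> T) \<le> card (M \<inter> T))"
  proof (rule ex_has_greatest_nat)
    show "P J" using J by (simp add: P_def)
    show "\<forall>M. P M \<longrightarrow> card (M \<inter> T) < Suc (card T)"
      using T(2) by (auto simp: less_Suc_eq_le intro: card_mono)
  qed
  then obtain M where M: "P M" and max: "\<And>M'. P M' \<Longrightarrow> card (M' \<inter> T) \<le> card (M \<inter> T)" by blast
  have iM: "ideal_set S M" and JM: "J \<subseteq> M" and M1: "1 \<notin> M" using M by (auto simp: P_def)
  note i = ideal_setD[OF S iM]
  have "\<exists>s\<in>S. r * s - 1 \<in> M" if r: "r \<in> S" "r \<notin> M" for r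
  proof (rule ccontr)
    assume no: "\<not> ?thesis"
    define M' where "M' = {y + r * s | y s. y \<in> M \<and> s \<in> S}"
    have MM': "M \<subseteq> M'" unfolding M'_def using subring_setD(1)[OF S] by force
    have rM': "r \<in> M'" unfolding M'_def using subring_setD(2)[OF S] i(2) by force
    have iM': "ideal_set S M'"
      unfolding ideal_set_def
    proof (intro conjI ballI)
      show "M' \<subseteq> S" unfolding M'_def using r i(1) by (auto intro!: subring_setD[OF S])
      show "0 \<in> M'" using MM' i(2) by auto
    next
      fix x y assume "x \<in> M'" "y \<in> M'"
      then obtain a s b t where *: "a \<in> M" "s \<in> S" "b \<in> M" "t \<in> S" "x = a + r * s" "y = b + r * t"
        by (auto simp: M'_def)
      then have "x + y = (a + b) + r * (s + t)" by (simp add: algebra_simps)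
      then show "x + y \<in> M'" unfolding M'_def using * i(3) subring_setD(4)[OF S] by blast
    next
      fix x y assume "x \<in> S" "y \<in> M'"
      then obtain b t where *: "b \<in> M" "t \<in> S" "y = b + r * t"
        by (auto simp: M'_def)
      then have "x * y = x * b + r * (x * t)" by (simp add: algebra_simps)
      then show "x * y \<in> M'" unfolding M'_def using * i(4) subring_setD(6)[OF S] \<open>x \<in> S\<close> by blast
    qed
    have "1 \<notin> M'"
    proof
      assume "1 \<in> M'"
      then obtain a s where as: "a \<in> M" "s \<in> S" "1 = a + r * s" by (auto simp: M'_def)
      have "r * s - 1 = - a" by (subst as(3)) simp
      then show False using no as i(6) by metis
    qed
    then have "P M'" using iM' JM MM' by (auto simp: P_def)
    then have "card (M' \<inter> T) \<le> card (M \<inter> T)" by (rule max)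
    then have eq: "M' \<inter> T = M \<inter> T" using MM' T(2) by (metis Int_mono card_seteq finite_Int order_refl)
    obtain t where t: "t \<in> T" "r - t \<in> J" using T(3) r by blast
    have "r - (r - t) \<in> M'" by (rule ideal_setD(7)[OF S iM' rM']) (use t MM' JM in blast)
    then have "t \<in> M" using t eq by auto
    with i(3)[of "r - t" t] t(2) JM show False using r by auto
  qed
  moreover have "finite_index S M"
    unfolding finite_index_def
  proof (intro exI[of _ T] conjI ballI T)
    fix r assume "r \<in> S"
    with T(3) JM show "\<exists>t\<in>T. r - t \<in> M" by (metis subsetD)
  qed
  ultimately show ?thesis using iM M1 JM by (auto simp: finite_maximal_def)
qed

text \<open>Division with remainder by \<open>A\<close> works modulo \<open>J\<close>, although the
  leading coefficient is invertible only modulo \<open>m\<close>.\<close>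

lemma reduce_degree:
  assumes R: "subring_set R" and m: "finite_maximal R m" and A: "A \<in> polys_over R" "lead_coeff A \<notin> m"
    and S: "subring_set S" and J: "ideal_set S J" and RS: "R \<subseteq> S" "x \<in> S"
    and mJ: "m \<subseteq> J" and Ax: "poly A x \<in> J"
    and p: "p \<in> polys_over R" "\<And>i. k \<le> i \<Longrightarrow> coeff p i = 0"
  shows "\<exists>q\<in>polys_over R. (\<forall>i\<ge>degree A. coeff q i = 0) \<and> poly p x - poly q x \<in> J"
  using p
proof (induction k arbitrary: p)
  case 0
  then show ?case using ideal_setD(2)[OF S J] by (intro bexI[of _ p]) auto
next
  case (Suc k)
  let ?n = "degree A" and ?a = "lead_coeff A" and ?c = "coeff p k"
  note Rp = subring_setD[OF subring_set_polys_over[OF R]]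
  show ?case
  proof (cases "k < ?n")
    case True
    then show ?thesis using Suc(2,3) ideal_setD(2)[OF S J] by (intro bexI[of _ p]) auto
  next
    case False
    then have kn: "?n \<le> k" by simp
    have aR: "?a \<in> R" using polys_overD[OF A(1)] .
    obtain s where s: "s \<in> R" "?a * s - 1 \<in> m" using m A(2) aR by (auto simp: finite_maximal_def)
    have c: "?c \<in> R" using polys_overD Suc(2) by blast
    \<comment> \<open>\<open>u * A\<close> cancels the top coefficient \<open>?c\<close> up to a
      multiple of \<open>?a * s - 1\<close>. That error lies in \<open>m\<close> and is removed by
      \<open>v\<close>, whose value lies in \<open>J\<close>.\<close>
    define u where "u = monom (?c * s) (k - ?n)"
    define v where "v = monom (?c - ?c * s * ?a) k"
    define p' where "p' = p - u * A - v"
    have uv: "u \<in> polys_over R" "v \<in> polys_over R"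
      unfolding u_def v_def using R c s aR by (auto intro!: polys_over_monom subring_setD[OF R])
    have p': "p' \<in> polys_over R" unfolding p'_def using Suc(2) uv A by (intro Rp)
    have "coeff p' i = 0" if "k \<le> i" for i
    proof (cases "i = k")
      case True
      then show ?thesis using kn by (simp add: p'_def u_def v_def coeff_monom_mult)
    next
      case False
      then have "coeff A (i - (k - ?n)) = 0" using that kn by (intro coeff_eq_0) auto
      then show ?thesis using False that Suc(3)[of i]
        by (simp add: p'_def u_def v_def coeff_monom_mult)
    qed
    from Suc(1)[OF p' this] obtain q where q: "q \<in> polys_over R" "\<forall>i\<ge>?n. coeff q i = 0"
      "poly p' x - poly q x \<in> J" by auto
    have ms: "?c * (?a * s - 1) \<in> m" using m c s by (auto simp: finite_maximal_def ideal_set_def)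
    have "poly u x \<in> S" using uv polys_over_mono[OF RS(1)] S RS(2) by (intro poly_in_subring_set) auto
    then have "poly u x * poly A x \<in> J" using Ax by (intro ideal_setD(4)[OF S J])
    moreover have "- (?c * (?a * s - 1)) * x ^ k \<in> J"
      by (rule ideal_setD(5)[OF S J subring_set_power[OF S RS(2)] ideal_setD(6)[OF S J subsetD[OF mJ ms]]])
    ultimately have "poly u x * poly A x + - (?c * (?a * s - 1)) * x ^ k + (poly p' x - poly q x) \<in> J"
      by (rule ideal_setD(3)[OF S J ideal_setD(3)[OF S J] q(3)])
    moreover have "poly p x - poly q x =
        poly u x * poly A x + - (?c * (?a * s - 1)) * x ^ k + (poly p' x - poly q x)"
      by (simp add: p'_def v_def poly_monom algebra_simps)
    ultimately have "poly p x - poly q x \<in> J" by (simp only:)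
    then show ?thesis using q by blast
  qed
qed

text \<open>Modulo \<open>J\<close> every element is a combination of the powers
  \<open>x ^ i\<close> with \<open>i < degree A\<close>, and the coefficients matter only modulo
  \<open>m\<close>. Finitely many representatives remain.\<close>

lemma finite_index_adjoin:
  assumes R: "subring_set R" and m: "finite_maximal R m" and A: "A \<in> polys_over R" "lead_coeff A \<notin> m"
    and J: "ideal_set (adjoin R x) J" and mJ: "m \<subseteq> J" and Ax: "poly A x \<in> J"
  shows "finite_index (adjoin R x) J"
proof -
  let ?S = "adjoin R x" and ?n = "degree A"
  note S = subring_set_adjoin[OF R, of x] and sup = adjoin_superset[OF R]
  obtain T where T: "T \<subseteq> R" "finite T" "\<And>r. r \<in> R \<Longrightarrow> \<exists>t\<in>T. r - t \<in> m"
    using m by (auto simp: finite_index_def finite_maximal_def)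
  define U where "U = (\<lambda>t. \<Sum>i<?n. t i * x ^ i) ` PiE {..<?n} (\<lambda>_. T)"
  have "finite U" unfolding U_def using T(2) by (intro finite_imageI finite_PiE) auto
  moreover have "U \<subseteq> ?S"
    unfolding U_def using T(1) sup(1)
    by (auto intro!: subring_set_sum S subring_setD(6)[OF S] subring_set_power sup(2))
  moreover have "\<exists>t\<in>U. r - t \<in> J" if "r \<in> ?S" for r
  proof -
    obtain p where p: "p \<in> polys_over R" "r = poly p x" using \<open>r \<in> ?S\<close> by (auto simp: adjoin_def)
    have "\<And>i. Suc (degree p) \<le> i \<Longrightarrow> coeff p i = 0" by (simp add: coeff_eq_0)
    from reduce_degree[OF R m A S J sup mJ Ax p(1) this]
    obtain q where q: "q \<in> polys_over R" "\<And>i. ?n \<le> i \<Longrightarrow> coeff q i = 0" "r - poly q x \<in> J"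
      using p(2) by auto
    have "\<exists>t. \<forall>i. t i \<in> T \<and> coeff q i - t i \<in> m" using T(3)[OF polys_overD[OF q(1)]] by (intro choice) blast
    then obtain t where t: "\<And>i. t i \<in> T" "\<And>i. coeff q i - t i \<in> m" by auto
    have qx: "poly q x = (\<Sum>i<?n. coeff q i * x ^ i)"
      unfolding poly_altdef
    proof (cases "?n = 0")
      case True
      then have "q = 0" using q(2) by (simp add: poly_eq_iff)
      then show "(\<Sum>i\<le>degree q. coeff q i * x ^ i) = (\<Sum>i<?n. coeff q i * x ^ i)" by simp
    next
      case False
      then have "degree q < ?n" using q(2) by (metis leading_coeff_0_iff degree_0 gr0I linorder_not_less)
      then show "(\<Sum>i\<le>degree q. coeff q i * x ^ i) = (\<Sum>i<?n. coeff q i * x ^ i)"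
        by (intro sum.mono_neutral_left) (auto simp: coeff_eq_0)
    qed
    have "(\<Sum>i<?n. (coeff q i - t i) * x ^ i) \<in> J"
      using t(2) mJ by (intro ideal_set_sum[OF S J] ideal_setD(5)[OF S J] subring_set_power S sup(2)) auto
    then have "(r - poly q x) + (\<Sum>i<?n. (coeff q i - t i) * x ^ i) \<in> J"
      using q(3) by (intro ideal_setD(3)[OF S J])
    also have "(r - poly q x) + (\<Sum>i<?n. (coeff q i - t i) * x ^ i) = r - (\<Sum>i<?n. t i * x ^ i)"
      by (simp add: qx left_diff_distrib sum_subtractf)
    also have "(\<Sum>i<?n. t i * x ^ i) = (\<Sum>i<?n. restrict t {..<?n} i * x ^ i)" by simp
    finally have "r - (\<Sum>i<?n. restrict t {..<?n} i * x ^ i) \<in> J" .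
    moreover have "restrict t {..<?n} \<in> PiE {..<?n} (\<lambda>_. T)" using t(1) by auto
    ultimately show ?thesis unfolding U_def by blast
  qed
  ultimately show ?thesis unfolding finite_index_def by blast
qed

text \<open>Lying over: if \<open>x\<close> is a root of \<open>A\<close> with leading coefficient outside \<open>m\<close>, then \<open>m\<close> generates
  a proper ideal of \<open>R[x]\<close>. Otherwise \<open>B = 1 - u\<close> with \<open>u\<close> over \<open>m\<close> also vanishes at \<open>x\<close>, and
  eliminating the top coefficient of \<open>B\<close> or the constant coefficient of \<open>A\<close> lowers the degrees
  until one of them is a nonzero constant.\<close>

lemma chevalley_descent:
  fixes x :: "'f::field"
  assumes R: "subring_set R" and m: "finite_maximal R m" and x: "x \<noteq> 0"
    and A: "A \<in> polys_over R" "poly A x = 0" "\<And>i. n < i \<Longrightarrow> coeff A i = 0" "coeff A n \<notin> m"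
    and B: "B \<in> polys_over R" "poly B x = 0" "\<And>i. N < i \<Longrightarrow> coeff B i = 0" "coeff B 0 \<notin> m"
      "\<And>i. 0 < i \<Longrightarrow> coeff B i \<in> m"
  shows False
  using A B
proof (induction "n + N" arbitrary: n N A B rule: less_induct)
  case less
  note A = less(2-5) and B = less(6-10)
  have im: "ideal_set R m" using m by (simp add: finite_maximal_def)
  note i = ideal_setD[OF R im] and Rp = subring_setD[OF subring_set_polys_over[OF R]]
  note AR = polys_overD[OF A(1)] and BR = polys_overD[OF B(1)]
  have const: "\<exists>c. p = [:c:]" if "\<And>i. 0 < i \<Longrightarrow> coeff p i = 0" for p :: "'f poly"
    using that by (metis degree_eq_zeroE gr0I leading_coeff_0_iff degree_0)
  have "n \<noteq> 0"
  proof
    assume "n = 0"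
    with const[of A] A(3) obtain c where "A = [:c:]" by auto
    then show False using A(2,4) \<open>n = 0\<close> i(2) by simp
  qed
  have "N \<noteq> 0"
  proof
    assume "N = 0"
    with const[of B] B(3) obtain c where "B = [:c:]" by auto
    then show False using B(2,4) i(2) by simp
  qed
  have prod: "r * s \<notin> m" if "r \<notin> m" "s \<notin> m" "r \<in> R" "s \<in> R" for r s
    using finite_maximal_prime[OF R m that(3,4)] that by blast
  show False
  proof (cases "n \<le> N")
    case True
    \<comment> \<open>The coefficient at \<open>N\<close> cancels. Since \<open>coeff B N\<close>
      lies in \<open>m\<close>, the subtracted part has all coefficients in \<open>m\<close>, so the
      constant term stays outside \<open>m\<close> and the others inside.\<close>
    define B' where "B' = [:coeff A n:] * B - monom (coeff B N) (N - n) * A"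
    have cB': "coeff B' j = coeff A n * coeff B j -
        (if N - n \<le> j then coeff B N * coeff A (j - (N - n)) else 0)" for j
      by (simp add: B'_def coeff_monom_mult)
    have BNm: "coeff B N \<in> m" using B(5) \<open>N \<noteq> 0\<close> by simp
    then have e: "(if N - n \<le> j then coeff B N * coeff A (j - (N - n)) else 0) \<in> m" for j
      using i(2,5) AR by auto
    show False
    proof (rule less(1)[of n "N - 1" A B'])
      show "n + (N - 1) < n + N" using \<open>N \<noteq> 0\<close> by simp
      show "B' \<in> polys_over R" unfolding B'_def
        using A(1) B(1) AR BR R by (intro Rp polys_over_pCons polys_over_monom)
      show "poly B' x = 0" using A(2) B(2) by (simp add: B'_def)
      show "coeff B' j = 0" if "N - 1 < j" for j
      proof (cases "j = N")
        case True
        then show ?thesis using \<open>n \<le> N\<close> by (simp add: cB' mult.commute)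
      next
        case False
        then have "N < j" using that by simp
        then have "coeff B j = 0" "coeff A (j - (N - n)) = 0" using True by (auto intro!: A(3) B(3))
        then show ?thesis by (simp add: cB')
      qed
      show "coeff B' 0 \<notin> m"
      proof
        assume "coeff B' 0 \<in> m"
        from i(3)[OF this e[of 0]] have "coeff A n * coeff B 0 \<in> m" by (simp add: cB')
        then show False using prod[OF A(4) B(4)] AR BR by blast
      qed
      show "coeff B' j \<in> m" if "0 < j" for j
        unfolding cB' using B(5)[OF that] AR e by (intro i(4,7))
    qed (use A in auto)
  next
    case False
    \<comment> \<open>The constant term cancels and the polynomial can be divided by
      \<open>X\<close>, because \<open>x\<close> is nonzero. As \<open>N < n\<close>, the polynomial
      \<open>B\<close> does not reach the top coefficient, which becomes a product of two elements
      outside \<open>m\<close>.\<close>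
    define A' where "A' = [:coeff B 0:] * A - [:coeff A 0:] * B"
    obtain c A'' where cA: "A' = pCons c A''" by (cases A')
    have "c = coeff A' 0" by (simp add: cA)
    also have "\<dots> = 0" by (simp add: A'_def mult.commute)
    finally have c0: "c = 0" .
    have cA'': "coeff A'' j = coeff B 0 * coeff A (Suc j) - coeff A 0 * coeff B (Suc j)" for j
    proof -
      have "coeff A'' j = coeff A' (Suc j)" by (simp add: cA)
      then show ?thesis by (simp add: A'_def)
    qed
    show False
    proof (rule less(1)[of "n - 1" N A'' B])
      show "n - 1 + N < n + N" using \<open>n \<noteq> 0\<close> by simp
      show "A'' \<in> polys_over R" unfolding polys_over_def using AR BR
        by (auto simp: cA'' intro!: subring_setD[OF R])
      have "poly A' x = 0" using A(2) B(2) by (simp add: A'_def)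
      then show "poly A'' x = 0" using x by (simp add: cA c0)
      show "coeff A'' j = 0" if "n - 1 < j" for j
        using that False A(3)[of "Suc j"] B(3)[of "Suc j"] by (simp add: cA'')
      have "coeff A'' (n - 1) = coeff B 0 * coeff A n"
        using \<open>n \<noteq> 0\<close> False B(3)[of n] by (simp add: cA'')
      then show "coeff A'' (n - 1) \<notin> m" using prod[OF B(4) A(4)] AR BR by simp
    qed (use B in auto)
  qed
qed

text \<open>This is the extension of \<open>m\<close> to \<open>R[x]\<close>. Its description by
  polynomials turns membership of \<open>1\<close> into a relation with coefficients in
  \<open>m\<close>.\<close>

lemma ideal_set_poly_image:
  assumes R: "subring_set R" and m: "ideal_set R m"
  shows "ideal_set (adjoin R x) ((\<lambda>p. poly p x) ` polys_over m)" (is "ideal_set _ ?J")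
  unfolding ideal_set_def
proof (intro conjI ballI)
  note i = ideal_setD[OF R m]
  have "polys_over m \<subseteq> polys_over R" using i(1) by (intro polys_over_mono) auto
  then show "?J \<subseteq> adjoin R x" by (auto simp: adjoin_def)
  show "0 \<in> ?J" by (rule image_eqI[of _ _ 0]) (use i(2) in \<open>auto simp: polys_over_def\<close>)
next
  note i = ideal_setD[OF R m]
  fix y z assume "y \<in> ?J" "z \<in> ?J"
  then obtain p q where "p \<in> polys_over m" "q \<in> polys_over m" "y = poly p x" "z = poly q x" by auto
  then show "y + z \<in> ?J"
    by (intro image_eqI[of _ _ "p + q"]) (auto simp: polys_over_def image_subset_iff intro!: i(3))
next
  note i = ideal_setD[OF R m]
  fix y z assume "y \<in> adjoin R x" "z \<in> ?J"
  then obtain p q where "p \<in> polys_over R" "q \<in> polys_over m" "y = poly p x" "z = poly q x"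
    by (auto simp: adjoin_def)
  then show "y * z \<in> ?J"
    by (intro image_eqI[of _ _ "p * q"])
      (auto simp: polys_over_def image_subset_iff coeff_mult intro!: ideal_set_sum[OF R m] i(4))
qed

text \<open>An element of \<open>M \<inter> R\<close> outside \<open>m\<close> would be invertible
  modulo \<open>m\<close>, hence modulo \<open>M\<close>, and \<open>M\<close> would not be
  proper.\<close>

lemma finite_maximal_contract:
  assumes R: "subring_set R" and S: "subring_set S" and m: "finite_maximal R m" and M: "finite_maximal S M"
    and "R \<subseteq> S" "m \<subseteq> M"
  shows "M \<inter> R = m"
proof
  show "m \<subseteq> M \<inter> R" using assms(6) m by (auto simp: finite_maximal_def ideal_set_def)
  have iM: "ideal_set S M" "1 \<notin> M" using M by (auto simp: finite_maximal_def)
  show "M \<inter> R \<subseteq> m"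
  proof (rule subsetI, rule ccontr)
    fix r assume r: "r \<in> M \<inter> R" "r \<notin> m"
    then obtain s where s: "s \<in> R" "r * s - 1 \<in> m" using m by (auto simp: finite_maximal_def)
    have "r * s \<in> M" "r * s - 1 \<in> M"
      using s r assms(5,6) ideal_setD(5)[OF S iM(1), of s r] by auto
    from ideal_setD(7)[OF S iM(1) this] show False using iM(2) by simp
  qed
qed

text \<open>The contraction \<open>M \<inter> R = m\<close> is the point: coefficients kept outside
  \<open>m\<close> stay outside when further algebraic elements are adjoined.\<close>

lemma finite_maximal_algebraic:
  fixes x :: "'f::field"
  assumes R: "subring_set R" and m: "finite_maximal R m"
    and A: "A \<in> polys_over R" "poly A x = 0" "lead_coeff A \<notin> m"
  shows "\<exists>M. finite_maximal (adjoin R x) M \<and> M \<inter> R = m"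
proof -
  let ?J = "(\<lambda>p. poly p x) ` polys_over m"
  note S = subring_set_adjoin[OF R, of x]
  have im: "ideal_set R m" and m1: "1 \<notin> m" using m by (auto simp: finite_maximal_def)
  note i = ideal_setD[OF R im]
  have J: "ideal_set (adjoin R x) ?J" using R im by (rule ideal_set_poly_image)
  have mJ: "m \<subseteq> ?J"
  proof
    fix a assume "a \<in> m"
    then have "[:a:] \<in> polys_over m" by (intro polys_over_pCons) (auto simp: polys_over_def i(2))
    then show "a \<in> ?J" by (rule rev_image_eqI) simp
  qed
  have "poly A x \<in> ?J" using A(2) ideal_setD(2)[OF S J] by simp
  with finite_index_adjoin[OF R m A(1,3) J mJ] have fin: "finite_index (adjoin R x) ?J" by simp
  have "1 \<notin> ?J"
  proof
    assume "1 \<in> ?J"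
    then obtain u where u: "u \<in> polys_over m" "poly u x = 1" by auto
    note um = polys_overD[OF u(1)]
    show False
    \<comment> \<open>\<open>chevalley_descent\<close> divides by \<open>x\<close>. At
      \<open>x = 0\<close> the relation reads \<open>coeff u 0 = 1\<close> and contradicts
      \<open>1 \<notin> m\<close> directly.\<close>
    proof (cases "x = 0")
      case True
      then show False using u um[of 0] m1 by (simp add: poly_0_coeff_0)
    next
      case False
      have cB: "coeff (1 - u) j = (if j = 0 then 1 else 0) - coeff u j" for j by (simp add: coeff_1)
      have "1 - u \<in> polys_over R"
        using um i(1) subring_setD(1,2)[OF R] by (auto simp: polys_over_def cB intro!: subring_setD(5)[OF R])
      moreover have "coeff (1 - u) 0 \<notin> m"
      proof
        assume "coeff (1 - u) 0 \<in> m"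
        from i(3)[OF this um[of 0]] m1 show False by simp
      qed
      moreover have "coeff (1 - u) j \<in> m" if "0 < j" for j
        using that um[of j] i(6) by (simp add: cB)
      ultimately show False
        using chevalley_descent[OF R m False A(1,2) coeff_eq_0 A(3), of "1 - u", OF _ _ _ coeff_eq_0]
          u(2) by auto
    qed
  qed
  from finite_maximal_extend[OF S J this fin] obtain M where M: "finite_maximal (adjoin R x) M" "?J \<subseteq> M" by auto
  have "M \<inter> R = m" using mJ M(2) by (intro finite_maximal_contract[OF R S m M(1) adjoin_superset(1)[OF R]]) auto
  then show ?thesis using M by blast
qed

text \<open>Homomorphisms onto finite fields separate the nonzero elements of \<open>R\<close> from
  zero.\<close>

definition finitely_separated :: "'a::comm_ring_1 set \<Rightarrow> bool" where
  "finitely_separated R \<longleftrightarrow> (\<forall>r\<in>R. r \<noteq> 0 \<longrightarrow> (\<exists>m. finite_maximal R m \<and> r \<notin> m))"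

text \<open>\<open>R[x]\<close> is a polynomial ring here, so besides \<open>m\<close> one relation
  must be imposed on \<open>x\<close> to make the quotient finite. The relation is chosen to make
  \<open>s\<close> invertible at the same time.\<close>

lemma finitely_separated_transcendental:
  fixes x :: "'f::field"
  assumes R: "subring_set R" and g: "finitely_separated R"
    and tr: "\<And>q. q \<in> polys_over R \<Longrightarrow> poly q x = 0 \<Longrightarrow> q = 0"
  shows "finitely_separated (adjoin R x)"
  unfolding finitely_separated_def
proof (intro ballI impI)
  let ?S = "adjoin R x"
  note S = subring_set_adjoin[OF R, of x] and Rp = subring_setD[OF subring_set_polys_over[OF R]]
  fix s assume s: "s \<in> ?S" "s \<noteq> 0"
  then obtain p where p: "p \<in> polys_over R" "s = poly p x" by (auto simp: adjoin_def)
  have p0: "p \<noteq> 0" using s p by auto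
  have "lead_coeff p \<in> R" using polys_overD[OF p(1)] .
  then obtain m where m: "finite_maximal R m" "lead_coeff p \<notin> m" using g p0 by (auto simp: finitely_separated_def)
  have im: "ideal_set R m" and m1: "1 \<notin> m" using m(1) by (auto simp: finite_maximal_def)
  note i = ideal_setD[OF R im]
  \<comment> \<open>\<open>f = X p + 1\<close>: modulo \<open>f\<close> the element \<open>s = p(x)\<close> becomes a unit with inverse \<open>- x\<close>.\<close>
  define f where "f = pCons 1 p"
  have f: "f \<in> polys_over R" unfolding f_def using p(1) subring_setD(2)[OF R] by (rule polys_over_pCons[rotated])
  have lf: "lead_coeff f = lead_coeff p" and df: "degree f = Suc (degree p)"
    using p0 by (auto simp: f_def)
  define J where "J = {y + z * poly f x | y z. y \<in> (\<lambda>p. poly p x) ` polys_over m \<and> z \<in> ?S}"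
  have J0: "ideal_set ?S ((\<lambda>p. poly p x) ` polys_over m)" (is "ideal_set _ ?J0")
    using R im by (rule ideal_set_poly_image)
  note j0 = ideal_setD[OF S J0]
  have fS: "poly f x \<in> ?S" using f by (auto simp: adjoin_def)
  have J: "ideal_set ?S J"
    unfolding ideal_set_def
  proof (intro conjI ballI)
    show "J \<subseteq> ?S" unfolding J_def using j0(1) fS by (auto intro!: subring_setD[OF S])
    show "0 \<in> J" unfolding J_def using j0(2) subring_setD(1)[OF S] by force
  next
    fix a b assume "a \<in> J" "b \<in> J"
    then obtain y z y' z' where *: "y \<in> ?J0" "z \<in> ?S" "y' \<in> ?J0" "z' \<in> ?S"
      "a = y + z * poly f x" "b = y' + z' * poly f x" unfolding J_def by blast
    then have "a + b = (y + y') + (z + z') * poly f x" by (simp add: algebra_simps)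
    then show "a + b \<in> J" unfolding J_def using * j0(3) subring_setD(4)[OF S] by blast
  next
    fix a b assume "a \<in> ?S" "b \<in> J"
    then obtain y z where *: "y \<in> ?J0" "z \<in> ?S" "b = y + z * poly f x" unfolding J_def by blast
    then have "a * b = a * y + (a * z) * poly f x" by (simp add: algebra_simps)
    then show "a * b \<in> J" unfolding J_def using * j0(4) subring_setD(6)[OF S] \<open>a \<in> ?S\<close> by blast
  qed
  have mJ: "m \<subseteq> J"
  proof
    fix a assume "a \<in> m"
    then have "[:a:] \<in> polys_over m" by (intro polys_over_pCons) (auto simp: polys_over_def i(2))
    then have "poly [:a:] x \<in> ?J0" by (rule imageI)
    then have "poly [:a:] x + 0 * poly f x \<in> J" unfolding J_def using subring_setD(1)[OF S] by blast
    then show "a \<in> J" by simp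
  qed
  have fJ: "poly f x \<in> J" unfolding J_def using j0(2) subring_setD(2)[OF S] by force
  have "lead_coeff f \<notin> m" using lf m(2) by simp
  from finite_index_adjoin[OF R m(1) f this J mJ fJ] have fin: "finite_index ?S J" .
  have "1 \<notin> J"
  proof
    assume "1 \<in> J"
    then obtain u v where u: "u \<in> polys_over m" and v: "v \<in> polys_over R"
      and 1: "1 = poly u x + poly v x * poly f x" unfolding J_def adjoin_def by blast
    have "u \<in> polys_over R" using u polys_over_mono[of m R] i(1) by blast
    then have "u + v * f - 1 \<in> polys_over R" using v f by (intro Rp)
    then have "u + v * f - 1 = 0" by (rule tr) (simp add: 1[symmetric])
    then have eq: "u + v * f = 1" by simp
    \<comment> \<open>Modulo \<open>m\<close> the equation reads \<open>v * f = 1\<close>, while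
      \<open>f\<close> has positive degree there. The last coefficient of \<open>v\<close> outside
      \<open>m\<close>, at position \<open>k\<close>, would survive at position
      \<open>k + degree f\<close> of the product.\<close>
    have vm: "coeff v j \<in> m" for j
    proof (rule ccontr)
      assume nj: "coeff v j \<notin> m"
      have fs: "finite {j. coeff v j \<notin> m}"
      proof (rule finite_subset)
        show "{j. coeff v j \<notin> m} \<subseteq> {..degree v}" using i(2) le_degree[of v] by force
      qed simp
      define k where "k = Max {j. coeff v j \<notin> m}"
      have k: "coeff v k \<notin> m" using Max_in[OF fs] nj unfolding k_def by blast
      have above: "coeff v l \<in> m" if "k < l" for l
        using that Max_ge[OF fs, of l] unfolding k_def by force
      let ?N = "k + degree f"
      have "coeff (v * f) ?N = (\<Sum>l\<le>?N. coeff v l * coeff f (?N - l))" by (simp add: coeff_mult)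
      also have "\<dots> = coeff v k * lead_coeff f + (\<Sum>l\<in>{..?N} - {k}. coeff v l * coeff f (?N - l))"
        (is "_ = _ + ?Sg")
        by (subst sum.remove[of _ k]) auto
      finally have e1: "coeff (v * f) ?N = coeff v k * lead_coeff f + ?Sg" .
      have e2: "coeff u ?N + coeff (v * f) ?N = 0"
        using arg_cong[OF eq, of "\<lambda>q. coeff q ?N"] df by (simp add: coeff_1)
      have "b = (a + (b + c)) - a - c" for a b c :: 'f by simp
      from this[of "coeff v k * lead_coeff f" "coeff u ?N" ?Sg]
      have e3: "coeff v k * lead_coeff f = 0 - coeff u ?N - ?Sg" unfolding e2[unfolded e1] .
      have "coeff v k * lead_coeff f \<in> m"
        unfolding e3
      proof (intro i(7) i(2) polys_overD[OF u] ideal_set_sum[OF R im])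
        fix l assume l: "l \<in> {..?N} - {k}"
        show "coeff v l * coeff f (?N - l) \<in> m"
        proof (cases "k < l")
          case True
          then show ?thesis using above polys_overD[OF f] i(5) by blast
        next
          case False
          then have "coeff f (?N - l) = 0" using l by (intro coeff_eq_0) auto
          then show ?thesis using i(2) by simp
        qed
      qed
      from finite_maximal_prime[OF R m(1) polys_overD[OF v] polys_overD[OF f] this] show False
        using k m(2) unfolding lf by blast
    qed
    have "1 = coeff u 0 + coeff v 0" using arg_cong[OF eq, of "\<lambda>q. coeff q 0"]
      by (simp add: coeff_mult f_def)
    then show False using m1 i(3)[OF polys_overD[OF u, of 0] vm[of 0]] by simp
  qed
  from finite_maximal_extend[OF S J this fin] obtain M where M: "finite_maximal ?S M" "J \<subseteq> M" by auto
  have "s \<notin> M"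
  proof
    assume sM: "s \<in> M"
    have iM: "ideal_set ?S M" using M by (simp add: finite_maximal_def)
    have "poly f x - x * s \<in> M"
      using fJ M(2) sM adjoin_superset[OF R] by (intro ideal_setD(4,7)[OF S iM]) auto
    then show False using M(1) by (simp add: f_def p(2) finite_maximal_def)
  qed
  then show "\<exists>m. finite_maximal ?S m \<and> s \<notin> m" using M by blast
qed

lemma ring_span_empty: "ring_span {} = range of_int"
proof
  have "subring_set (range of_int)"
    unfolding subring_set_def
    by (auto simp flip: of_int_diff of_int_mult intro: range_eqI[of _ _ 1])
  then show "ring_span {} \<subseteq> range of_int" by (rule ring_span_least) auto
  have nat: "of_nat n \<in> ring_span {}" for n
    by (induction n) (auto simp: subring_setD[OF subring_set_ring_span])
  have "of_int k \<in> ring_span {}" for k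
    by (cases k rule: int_cases2) (auto simp: nat subring_setD[OF subring_set_ring_span])
  then show "range of_int \<subseteq> ring_span {}" by auto
qed

lemma finitely_separated_prime_subring: "finitely_separated (ring_span {} :: 'f::field set)"
  unfolding finitely_separated_def
proof (intro ballI impI)
  fix r :: 'f assume "r \<in> ring_span {}" "r \<noteq> 0"
  then obtain k where k: "r = of_int k" by (auto simp: ring_span_empty)
  \<comment> \<open>The last conjunct says that the kernel of \<open>of_int\<close> consists of
    multiples of \<open>p\<close>, so divisibility by \<open>p\<close> can be read off from the
    image. In characteristic zero a prime above \<open>\<bar>k\<bar>\<close> serves, otherwise the
    characteristic itself.\<close>
  have "\<exists>p::int. prime p \<and> \<not> p dvd k \<and> (\<forall>l. of_int l = (0::'f) \<longrightarrow> p dvd l)"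
  proof (cases "CHAR('f) = 0")
    case True
    obtain q :: nat where q: "prime q" "nat \<bar>k\<bar> < q" using bigger_prime by blast
    have "k \<noteq> 0" using k \<open>r \<noteq> 0\<close> by auto
    then have "\<not> int q dvd k" using q(2) zdvd_imp_le[of "int q" "\<bar>k\<bar>"] by auto
    then show ?thesis using q True by (intro exI[of _ "int q"]) (auto simp: of_int_eq_0_iff_char_dvd)
  next
    case False
    then have "prime (int CHAR('f))" using prime_CHAR_semidom[where 'a = 'f] by simp
    then show ?thesis using k \<open>r \<noteq> 0\<close>
      by (intro exI[of _ "int CHAR('f)"]) (auto simp: of_int_eq_0_iff_char_dvd)
  qed
  then obtain p :: int where p: "prime p" "\<not> p dvd k"
    and char: "\<And>l. of_int l = (0::'f) \<Longrightarrow> p dvd l" by auto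
  define m :: "'f set" where "m = {of_int (p * j) | j. True}"
  have in_m: "(of_int l :: 'f) \<in> m \<longleftrightarrow> p dvd l" for l
  proof
    assume "(of_int l :: 'f) \<in> m"
    then obtain j where "of_int l = (of_int (p * j) :: 'f)" by (auto simp: m_def)
    then have "of_int (l - p * j) = (0::'f)" by simp
    from dvd_add[OF char[OF this] dvd_triv_left[of p j]] show "p dvd l" by simp
  next
    assume "p dvd l"
    then obtain j where "l = p * j" ..
    then show "(of_int l :: 'f) \<in> m" unfolding m_def by blast
  qed
  have m_sub: "m \<subseteq> range of_int" unfolding m_def by blast
  have ideal_span: "ideal_set (ring_span {}) m"
    unfolding ideal_set_def ring_span_empty
  proof (intro conjI ballI)
    show "m \<subseteq> range of_int" by (rule m_sub)
    show "0 \<in> m" using in_m[of 0] by simp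
  next
    fix x y assume xy: "x \<in> m" "y \<in> m"
    then obtain i j where "x = of_int i" "y = of_int j" using m_sub by blast
    then show "x + y \<in> m" using xy in_m[of "i + j"] by (auto simp: in_m)
  next
    fix x y :: 'f assume xy: "x \<in> range of_int" "y \<in> m"
    then obtain i j where "x = of_int i" "y = of_int j" using m_sub by blast
    then show "x * y \<in> m" using xy in_m[of "i * j"] by (auto simp: in_m)
  qed
  have "finite_index (ring_span {}) m"
    unfolding finite_index_def ring_span_empty
  proof (intro exI[of _ "of_int ` {0..<p}"] conjI ballI)
    fix x :: 'f assume "x \<in> range of_int"
    then obtain l where l: "x = of_int l" by auto
    have "x - of_int (l mod p) \<in> m" unfolding l of_int_diff[symmetric] in_m by simp
    moreover have "l mod p \<in> {0..<p}" using prime_gt_0_int[OF p(1)] by simp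
    ultimately show "\<exists>t\<in>of_int ` {0..<p}. x - t \<in> m" by blast
  qed auto
  moreover have "\<exists>s\<in>ring_span {}. x * s - 1 \<in> m" if x: "x \<in> ring_span {} - m" for x
  proof -
    obtain l where l: "x = of_int l" "\<not> p dvd l" using x by (auto simp: ring_span_empty in_m)
    then have "coprime l p" using p(1) by (metis prime_imp_coprime coprime_commute)
    then obtain u v where "u * l + v * p = 1" using bezout_int[of l p] by (auto simp: coprime_iff_gcd_eq_1)
    then have "l * u - 1 = p * (- v)" by (simp add: algebra_simps)
    then have "of_int (l * u - 1) \<in> m" unfolding in_m by simp
    then have "x * of_int u - 1 \<in> m" by (simp add: l(1))
    then show ?thesis by (auto simp: ring_span_empty)
  qed
  moreover have "1 \<notin> m" using in_m[of 1] prime_gt_1_int[OF p(1)] by simp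
  ultimately have "finite_maximal (ring_span {}) m" using ideal_span by (auto simp: finite_maximal_def)
  moreover have "r \<notin> m" using p(2) by (simp add: k in_m)
  ultimately show "\<exists>m. finite_maximal (ring_span {}) m \<and> r \<notin> m" by blast
qed

text \<open>An element transcendental over the current \<open>T\<close> joins it, which preserves
  separation; an algebraic one is left out with its relation. Enlarging \<open>T\<close> keeps the
  relations found before.\<close>

lemma transcendence_base:
  fixes Y :: "'f::field set"
  assumes "finite Y"
  shows "\<exists>T\<subseteq>Y. finitely_separated (ring_span T) \<and> (\<forall>y\<in>Y. \<exists>A\<in>polys_over (ring_span T). A \<noteq> 0 \<and> poly A y = 0)"
  using assms
proof (induction Y)
  case empty
  then show ?case using finitely_separated_prime_subring by auto
next
  case (insert y Y)
  then obtain T where T: "T \<subseteq> Y" "finitely_separated (ring_span T)"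
    "\<And>z. z \<in> Y \<Longrightarrow> \<exists>A\<in>polys_over (ring_span T). A \<noteq> 0 \<and> poly A z = 0" by blast
  show ?case
  proof (cases "\<exists>A\<in>polys_over (ring_span T). A \<noteq> 0 \<and> poly A y = 0")
    case True
    then show ?thesis using T by (intro exI[of _ T]) auto
  next
    case False
    then have "finitely_separated (adjoin (ring_span T) y)" using T(2) by (intro finitely_separated_transcendental subring_set_ring_span) auto
    then have g: "finitely_separated (ring_span (insert y T))" by (simp add: adjoin_ring_span)
    have mono: "polys_over (ring_span T) \<subseteq> polys_over (ring_span (insert y T))" by (intro polys_over_mono ring_span_mono) auto
    have "[:- y, 1:] \<in> polys_over (ring_span (insert y T))"
      by (intro polys_over_pCons subring_setD[OF subring_set_ring_span] subring_setD(1)[OF subring_set_polys_over] subring_set_ring_span ring_span_base) auto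
    then have "\<exists>A\<in>polys_over (ring_span (insert y T)). A \<noteq> 0 \<and> poly A y = 0"
      by (intro bexI[of _ "[:- y, 1:]"]) auto
    then show ?thesis using g T(1,3) mono by (intro exI[of _ "insert y T"]) blast
  qed
qed

text \<open>The remaining generators are algebraic over \<open>ring_span T\<close>, and each can be
  adjoined as long as the leading coefficient of its relation avoids the ideal.\<close>

lemma finite_index_separation:
  fixes X :: "'f::field set"
  assumes X: "finite X" and r: "r \<noteq> 0"
  shows "\<exists>S M. subring_set S \<and> X \<subseteq> S \<and> ideal_set S M \<and> finite_index S M \<and> r \<notin> M"
proof -
  \<comment> \<open>With \<open>1 / r\<close> adjoined, \<open>r\<close> is a unit and so lies in no proper ideal.\<close>
  define Y where "Y = insert (1 / r) X"
  have "finite Y" using X by (simp add: Y_def)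
  from transcendence_base[OF this] obtain T where T: "T \<subseteq> Y" "finitely_separated (ring_span T)"
    and "\<forall>y\<in>Y. \<exists>A\<in>polys_over (ring_span T). A \<noteq> 0 \<and> poly A y = 0" by blast
  then obtain A where A: "\<And>y. y \<in> Y \<Longrightarrow> A y \<in> polys_over (ring_span T) \<and> A y \<noteq> 0 \<and> poly (A y) y = 0"
    using bchoice[of Y] by metis
  note RT = subring_set_ring_span[of T]
  \<comment> \<open>One ideal avoiding the product avoids every leading coefficient.\<close>
  define a where "a = (\<Prod>y\<in>Y. lead_coeff (A y))"
  have prodR: "(\<Prod>y\<in>Z. lead_coeff (A y)) \<in> ring_span T" if "Z \<subseteq> Y" for Z
    using that A by (induction Z rule: infinite_finite_induct) (auto simp: subring_setD[OF RT] polys_overD)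
  have "a \<noteq> 0" using A \<open>finite Y\<close> by (auto simp: a_def)
  then obtain m where m: "finite_maximal (ring_span T) m" "a \<notin> m"
    using T(2) prodR[of Y] by (auto simp: finitely_separated_def a_def)
  have im: "ideal_set (ring_span T) m" using m by (simp add: finite_maximal_def)
  have lead: "lead_coeff (A y) \<notin> m" if "y \<in> Y" for y
  proof
    assume "lead_coeff (A y) \<in> m"
    then have "lead_coeff (A y) * (\<Prod>y\<in>Y - {y}. lead_coeff (A y)) \<in> m"
      by (intro ideal_setD(5)[OF RT im] prodR) auto
    then show False using m(2) that \<open>finite Y\<close> by (simp add: a_def prod.remove)
  qed
  \<comment> \<open>The leading coefficients lie in \<open>ring_span T\<close>, so contraction to
    \<open>m\<close> keeps them outside \<open>M\<close> through the whole induction.\<close>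
  have "\<exists>M. finite_maximal (ring_span (Z \<union> T)) M \<and> M \<inter> ring_span T = m" if "finite Z" "Z \<subseteq> Y" for Z
    using that
  proof (induction Z)
    case empty
    have "m \<inter> ring_span T = m" using im by (auto simp: ideal_set_def)
    then show ?case using m(1) by auto
  next
    case (insert z Z)
    then obtain M where M: "finite_maximal (ring_span (Z \<union> T)) M" "M \<inter> ring_span T = m" by auto
    have mono: "ring_span T \<subseteq> ring_span (Z \<union> T)" by (intro ring_span_mono) auto
    have z: "z \<in> Y" using insert by auto
    have "lead_coeff (A z) \<notin> M" using lead[OF z] M(2) polys_overD[of "A z"] A[OF z] by blast
    with finite_maximal_algebraic[OF subring_set_ring_span M(1), of "A z" z] A[OF z] polys_over_mono[OF mono]
    obtain M' where M': "finite_maximal (adjoin (ring_span (Z \<union> T)) z) M'" "M' \<inter> ring_span (Z \<union> T) = M" by blast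
    have "M' \<inter> ring_span T = m" using M'(2) M(2) mono by blast
    then show ?case using M'(1) by (auto simp: adjoin_ring_span)
  qed
  from this[OF \<open>finite Y\<close>] obtain M where M: "finite_maximal (ring_span (Y \<union> T)) M" by auto
  let ?S = "ring_span (Y \<union> T)"
  have iM: "ideal_set ?S M" using M by (simp add: finite_maximal_def)
  have "r \<notin> M"
  proof
    assume "r \<in> M"
    then have "1 / r * r \<in> M"
      by (intro ideal_setD(4)[OF subring_set_ring_span iM] ring_span_base) (auto simp: Y_def)
    then show False using M r by (simp add: finite_maximal_def)
  qed
  moreover have "X \<subseteq> ?S" by (auto simp: Y_def intro: ring_span_base)
  ultimately show ?thesis using M subring_set_ring_span[of "Y \<union> T"] unfolding finite_maximal_def by blast
qed

lemma noetherian_ring_span: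
  assumes "subring_set R" "noetherian R" "finite X"
  shows "noetherian (ring_span (R \<union> X))"
  using assms(3)
proof (induction X)
  case empty
  have "ring_span R = R" using ring_span_least[OF assms(1), of R] by (auto intro: ring_span_base)
  then show ?case using assms(2) by simp
next
  case (insert x X)
  then show ?case using noetherian_adjoin[OF subring_set_ring_span, of "R \<union> X" x] by (simp add: adjoin_ring_span)
qed

section \<open>Linear groups\<close>

text \<open>The constant functions are a copy of the field, so two terms of the sequence suffice:
  \<open>f 0\<close> is zero or a unit.\<close>

lemma noetherian_constants: "noetherian (range (\<lambda>c _. c) :: ('x \<Rightarrow> 'f::field) set)"
  unfolding noetherian_def
proof (intro allI impI)
  let ?R = "range (\<lambda>c _. c) :: ('x \<Rightarrow> 'f) set"
  fix f :: "nat \<Rightarrow> 'x \<Rightarrow> 'f"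
  assume f: "range f \<subseteq> ?R"
  show "\<exists>n. f n \<in> ideal_span ?R (f ` {..<n})"
  proof (cases "f 0 = 0")
    case True
    then show ?thesis by (intro exI[of _ 0]) (simp add: ideal_span_zero)
  next
    case False
    have "f 0 \<in> ?R" "f 1 \<in> ?R" using f by blast+
    then obtain a b where ab: "f 0 = (\<lambda>_. a)" "f 1 = (\<lambda>_. b)" by blast
    have "a \<noteq> 0" using False ab(1) by (auto simp: zero_fun_def)
    then have "f 1 = (\<lambda>_. b / a) * f 0 + 0" by (auto simp: ab times_fun_def plus_fun_def zero_fun_def simp del: One_nat_def)
    moreover have "(\<lambda>_. b / a) * f 0 + 0 \<in> ideal_span ?R (f ` {..<1})"
      by (intro ideal_span_step ideal_span_zero) auto
    ultimately have "f 1 \<in> ideal_span ?R (f ` {..<1})" by simp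
    then show ?thesis by blast
  qed
qed

lemma subring_set_constants: "subring_set (range (\<lambda>c _. c) :: ('x \<Rightarrow> 'a::comm_ring_1) set)"
  unfolding subring_set_def by (auto simp: one_fun_def fun_diff_def times_fun_def)

lemma sum_fun_apply: "(\<Sum>i\<in>I. f i) x = (\<Sum>i\<in>I. f i x)"
  by (induction I rule: infinite_finite_induct) auto

locale linear_group =
  fixes d :: nat and C :: "'f::field mat set" and G :: "'f mat monoid"
  assumes sub: "subgroup C (GL TYPE('f) d)"
    and G_def: "G = (GL TYPE('f) d)\<lparr>carrier := C\<rparr>"
begin

lemma group_GL: "group (GL TYPE('f) d)"
proof -
  interpret R: semiring "ring_mat TYPE('f) d ()" by (rule semiring_mat)
  show ?thesis unfolding GL_def by (rule R.units_group)
qed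

sublocale group G
  unfolding G_def by (rule subgroup.subgroup_is_group[OF sub group_GL])

lemma carrier_G [simp]: "carrier G = C"
  by (simp add: G_def)

lemma mult_G [simp]: "x \<otimes>\<^bsub>G\<^esub> y = x * y"
  by (simp add: G_def GL_def units_of_def ring_mat_simps)

lemma one_G [simp]: "\<one>\<^bsub>G\<^esub> = 1\<^sub>m d"
  by (simp add: G_def GL_def units_of_def ring_mat_simps)

lemma carrier_mat_G: "x \<in> C \<Longrightarrow> x \<in> carrier_mat d d"
  using subgroup.subset[OF sub] by (auto simp: GL_def units_of_def Units_def ring_mat_simps)

lemma index_mult_G:
  "x \<in> C \<Longrightarrow> y \<in> C \<Longrightarrow> a < d \<Longrightarrow> b < d \<Longrightarrow> (x * y) $$ (a, b) = (\<Sum>k<d. x $$ (a, k) * y $$ (k, b))"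
  using carrier_mat_G[of x] carrier_mat_G[of y]
  by (auto simp: scalar_prod_def lessThan_atLeast0 intro!: sum.cong)

lemma eq_G:
  assumes "x \<in> C" "y \<in> C" "\<And>a b. a < d \<Longrightarrow> b < d \<Longrightarrow> x $$ (a, b) = y $$ (a, b)"
  shows "x = y"
  using assms carrier_mat_G[of x] carrier_mat_G[of y] by (intro eq_matI) auto

section \<open>Values of group terms as polynomial functions of matrix entries\<close>

lemma term_val_closed: "range e \<subseteq> C \<Longrightarrow> term_val G e t \<in> C"
  by (induction t) (use m_closed one_closed inv_closed in auto)

text \<open>Entries of inverses count as coordinates of their own, which gives terms polynomial
  entries without determinants or adjugates.\<close>

definition coord_funs :: "nat \<Rightarrow> ((nat \<Rightarrow> 'f mat) \<Rightarrow> 'f) set" where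
  "coord_funs n =
     (\<lambda>(i, a, b) e. e i $$ (a, b)) ` ({..<n} \<times> {..<d} \<times> {..<d}) \<union>
     (\<lambda>(i, a, b) e. (inv\<^bsub>G\<^esub> e i) $$ (a, b)) ` ({..<n} \<times> {..<d} \<times> {..<d})"

definition poly_funs :: "nat \<Rightarrow> ((nat \<Rightarrow> 'f mat) \<Rightarrow> 'f) set" where
  "poly_funs n = ring_span (range (\<lambda>c _. c) \<union> coord_funs n)"

lemma subring_set_poly_funs: "subring_set (poly_funs n)"
  unfolding poly_funs_def by (rule subring_set_ring_span)

lemma noetherian_poly_funs: "noetherian (poly_funs n)"
  unfolding poly_funs_def
  by (intro noetherian_ring_span subring_set_constants noetherian_constants) (auto simp: coord_funs_def)

text \<open>Agreement is demanded only for assignments into \<open>C\<close>; elsewhere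
  \<open>inv\<close> carries no meaning.\<close>

definition represented :: "nat \<Rightarrow> ((nat \<Rightarrow> 'f mat) \<Rightarrow> 'f mat) \<Rightarrow> bool" where
  "represented n F \<longleftrightarrow> (\<forall>a<d. \<forall>b<d. \<exists>g\<in>poly_funs n. \<forall>e. range e \<subseteq> C \<longrightarrow> g e = F e $$ (a, b))"

lemma represented_mult:
  assumes "represented n F" "represented n F'"
    and "\<And>e. range e \<subseteq> C \<Longrightarrow> F e \<in> C" "\<And>e. range e \<subseteq> C \<Longrightarrow> F' e \<in> C"
  shows "represented n (\<lambda>e. F e * F' e)"
  unfolding represented_def
proof (intro allI impI)
  fix a b assume ab: "a < d" "b < d"
  have "\<forall>k\<in>{..<d}. \<exists>g\<in>poly_funs n. \<forall>e. range e \<subseteq> C \<longrightarrow> g e = F e $$ (a, k)"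
    "\<forall>k\<in>{..<d}. \<exists>g\<in>poly_funs n. \<forall>e. range e \<subseteq> C \<longrightarrow> g e = F' e $$ (k, b)"
    using assms(1,2) ab by (auto simp: represented_def)
  then obtain g h where
    g: "\<And>k. k < d \<Longrightarrow> g k \<in> poly_funs n \<and> (\<forall>e. range e \<subseteq> C \<longrightarrow> g k e = F e $$ (a, k))" and
    h: "\<And>k. k < d \<Longrightarrow> h k \<in> poly_funs n \<and> (\<forall>e. range e \<subseteq> C \<longrightarrow> h k e = F' e $$ (k, b))"
    by (metis bchoice lessThan_iff)
  show "\<exists>g\<in>poly_funs n. \<forall>e. range e \<subseteq> C \<longrightarrow> g e = (F e * F' e) $$ (a, b)"
  proof (intro bexI[of _ "\<Sum>k<d. g k * h k"] allI impI)
    show "(\<Sum>k<d. g k * h k) \<in> poly_funs n"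
      using g h by (intro subring_set_sum subring_setD(6) subring_set_poly_funs) auto
    fix e :: "nat \<Rightarrow> 'f mat" assume e: "range e \<subseteq> C"
    show "(\<Sum>k<d. g k * h k) e = (F e * F' e) $$ (a, b)"
      using g h e by (simp add: sum_fun_apply index_mult_G assms(3,4) ab)
  qed
qed

text \<open>The inverse is carried along in the induction because \<open>TInv\<close> exchanges the
  two halves of the claim.\<close>

lemma represented_term:
  assumes "term_vars t \<subseteq> {..<n}"
  shows "represented n (\<lambda>e. term_val G e t) \<and> represented n (\<lambda>e. inv\<^bsub>G\<^esub> (term_val G e t))"
  using assms
proof (induction t)
  case (TVar i)
  show ?case
    unfolding represented_def
  proof (intro conjI allI impI)
    fix a b assume "a < d" "b < d"
    then have "(\<lambda>e. e i $$ (a, b)) \<in> coord_funs n" "(\<lambda>e. (inv\<^bsub>G\<^esub> e i) $$ (a, b)) \<in> coord_funs n"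
      using TVar unfolding coord_funs_def by force+
    then have "(\<lambda>e. e i $$ (a, b)) \<in> poly_funs n" "(\<lambda>e. (inv\<^bsub>G\<^esub> e i) $$ (a, b)) \<in> poly_funs n"
      by (auto simp: poly_funs_def intro: ring_span_base)
    then show "\<exists>g\<in>poly_funs n. \<forall>e. range e \<subseteq> C \<longrightarrow> g e = term_val G e (TVar i) $$ (a, b)"
      "\<exists>g\<in>poly_funs n. \<forall>e. range e \<subseteq> C \<longrightarrow> g e = (inv\<^bsub>G\<^esub> (term_val G e (TVar i))) $$ (a, b)"
      by force+
  qed
next
  case TOne
  have c: "(\<lambda>_. c) \<in> poly_funs n" for c by (auto simp: poly_funs_def intro: ring_span_base)
  have "represented n (\<lambda>e. 1\<^sub>m d)"
    unfolding represented_def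
  proof (intro allI impI)
    fix a b
    show "\<exists>g\<in>poly_funs n. \<forall>e. range e \<subseteq> C \<longrightarrow> g e = (1\<^sub>m d) $$ (a, b)"
      by (rule bexI[OF _ c[of "(1\<^sub>m d) $$ (a, b)"]]) simp
  qed
  moreover have "inv\<^bsub>G\<^esub> (1\<^sub>m d) = 1\<^sub>m d" using inv_one by simp
  ultimately show ?case by simp
next
  case (TMult s t)
  have "represented n (\<lambda>e. term_val G e s * term_val G e t)"
    using TMult by (intro represented_mult term_val_closed) auto
  moreover have "represented n (\<lambda>e. inv\<^bsub>G\<^esub> (term_val G e t) * inv\<^bsub>G\<^esub> (term_val G e s))"
    using TMult inv_closed by (intro represented_mult) (auto simp: term_val_closed)
  moreover have "inv\<^bsub>G\<^esub> (term_val G e s * term_val G e t) = inv\<^bsub>G\<^esub> (term_val G e t) * inv\<^bsub>G\<^esub> (term_val G e s)"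
    if "range e \<subseteq> C" for e
    using inv_mult_group[of "term_val G e s" "term_val G e t"] that by (simp add: term_val_closed)
  ultimately show ?case by (simp add: represented_def)
next
  case (TInv t)
  moreover have "inv\<^bsub>G\<^esub> (inv\<^bsub>G\<^esub> (term_val G e t)) = term_val G e t" if "range e \<subseteq> C" for e
    using inv_inv[of "term_val G e t"] that by (simp add: term_val_closed)
  ultimately show ?case by (simp add: represented_def)
qed

lemma equationally_noetherian:
  assumes W: "\<And>t. t \<in> W \<Longrightarrow> term_vars t \<subseteq> {..<n}"
  shows "\<exists>W0\<subseteq>W. finite W0 \<and> (\<forall>e. range e \<subseteq> C \<longrightarrow>
     (\<forall>t\<in>W0. term_val G e t = \<one>\<^bsub>G\<^esub>) \<longrightarrow> (\<forall>t\<in>W. term_val G e t = \<one>\<^bsub>G\<^esub>))"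
proof -
  define Q where "Q g t \<longleftrightarrow> t \<in> W \<and> (\<exists>a<d. \<exists>b<d. \<forall>e. range e \<subseteq> C \<longrightarrow>
      g e = term_val G e t $$ (a, b) - (1\<^sub>m d) $$ (a, b))" for g t
  define A where "A = {g\<in>poly_funs n. \<exists>t. Q g t}"
  have "A \<subseteq> poly_funs n" by (auto simp: A_def)
  \<comment> \<open>The generators \<open>B\<close> are themselves entries of \<open>t - 1\<close>
    for terms \<open>t\<close> in \<open>W\<close>; one such term for each generator makes up the
    finite subsystem.\<close>
  from noetherian_finite_basis[OF subring_set_poly_funs noetherian_poly_funs this]
  obtain B where B: "B \<subseteq> A" "finite B" "A \<subseteq> ideal_span (poly_funs n) B" by blast
  have "\<forall>g\<in>B. \<exists>t. Q g t" using B(1) by (auto simp: A_def)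
  then obtain t where t: "\<And>g. g \<in> B \<Longrightarrow> Q g (t g)" using bchoice[of B Q] by blast
  have "term_val G e s = \<one>\<^bsub>G\<^esub>"
    if e: "range e \<subseteq> C" and z: "\<forall>s\<in>t ` B. term_val G e s = \<one>\<^bsub>G\<^esub>" and s: "s \<in> W" for e s
  proof -
    have zB: "g e = 0" if "g \<in> B" for g
      using t[OF that] z that e by (auto simp: Q_def)
    have zI: "g e = 0" if "g \<in> ideal_span (poly_funs n) B" for g
      using that by induction (auto simp: zB)
    have "term_val G e s = 1\<^sub>m d"
    proof (rule eq_G)
      show "term_val G e s \<in> C" by (rule term_val_closed[OF e])
      show "1\<^sub>m d \<in> C" using one_closed by simp
      fix a b assume ab: "a < d" "b < d"
      have "\<exists>g\<in>poly_funs n. \<forall>e. range e \<subseteq> C \<longrightarrow> g e = term_val G e s $$ (a, b)"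
        using represented_term[OF W[OF s]] ab by (simp add: represented_def)
      then obtain g where g: "g \<in> poly_funs n" "\<And>e. range e \<subseteq> C \<Longrightarrow> g e = term_val G e s $$ (a, b)"
        by blast
      define g' where "g' = g - (\<lambda>_. (1\<^sub>m d) $$ (a, b))"
      have "(\<lambda>_. (1\<^sub>m d) $$ (a, b)) \<in> poly_funs n" by (auto simp: poly_funs_def intro: ring_span_base)
      then have "g' \<in> poly_funs n" unfolding g'_def using g(1) by (intro subring_setD(5)[OF subring_set_poly_funs])
      moreover have "g' e = term_val G e s $$ (a, b) - (1\<^sub>m d) $$ (a, b)" if "range e \<subseteq> C" for e
        using g(2)[OF that] by (simp add: g'_def)
      then have "Q g' s" using s ab unfolding Q_def by blast
      ultimately have "g' e = 0" using zI B(3) by (auto simp: A_def)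
      then show "term_val G e s $$ (a, b) = (1\<^sub>m d) $$ (a, b)" using g(2)[OF e] by (simp add: g'_def)
    qed
    then show ?thesis by simp
  qed
  moreover have "t ` B \<subseteq> W" using t by (auto simp: Q_def)
  ultimately show ?thesis using B(2) by (intro exI[of _ "t ` B"]) auto
qed

section \<open>Reduction of matrices modulo an ideal of finite index\<close>

definition entries_in :: "'f set \<Rightarrow> 'f mat \<Rightarrow> bool" where
  "entries_in S x \<longleftrightarrow> (\<forall>a<d. \<forall>b<d. x $$ (a, b) \<in> S)"

definition cong_mod :: "'f set \<Rightarrow> 'f mat \<Rightarrow> 'f mat \<Rightarrow> bool" where
  "cong_mod M x y \<longleftrightarrow> (\<forall>a<d. \<forall>b<d. x $$ (a, b) - y $$ (a, b) \<in> M)"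

lemma entries_in_mult:
  "subring_set S \<Longrightarrow> x \<in> C \<Longrightarrow> y \<in> C \<Longrightarrow> entries_in S x \<Longrightarrow> entries_in S y \<Longrightarrow> entries_in S (x * y)"
  by (auto simp: entries_in_def index_mult_G intro!: subring_set_sum subring_setD(6))

lemma cong_mod_mult:
  assumes "subring_set S" "ideal_set S M" "x \<in> C" "y \<in> C" "z \<in> C" "entries_in S z" "cong_mod M x y"
  shows "cong_mod M (z * x) (z * y)"
  using assms
  by (auto simp: cong_mod_def entries_in_def index_mult_G simp flip: sum_subtractf right_diff_distrib
      intro!: ideal_set_sum[OF assms(1,2)] ideal_setD(4)[OF assms(1,2)])

lemma cong_mod_trans:
  assumes "subring_set S" "ideal_set S M" "cong_mod M x y" "cong_mod M y z"
  shows "cong_mod M x z"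
  unfolding cong_mod_def
proof (intro allI impI)
  fix a b assume "a < d" "b < d"
  then have "(x $$ (a, b) - y $$ (a, b)) + (y $$ (a, b) - z $$ (a, b)) \<in> M"
    using assms(3,4) by (intro ideal_setD(3)[OF assms(1,2)]) (auto simp: cong_mod_def)
  then show "x $$ (a, b) - z $$ (a, b) \<in> M" by simp
qed

lemma ex_non_power:
  assumes fg: "fin_gen G" and g: "g \<in> C" "g \<noteq> \<one>\<^bsub>G\<^esub>"
  shows "\<exists>n>0. \<forall>q\<in>C. q [^]\<^bsub>G\<^esub> (n::nat) \<noteq> g"
proof -
  obtain S0 where S0: "S0 \<subseteq> C" "finite S0" "generate G S0 = C"
    using fg by (auto simp: fin_gen_def)
  \<comment> \<open>Entries of inverses are included because \<open>generate\<close> uses them;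
    \<open>S\<close> then contains the entries of every element of \<open>C\<close>.\<close>
  define X where "X = (\<lambda>(x, a, b). x $$ (a, b)) ` ((S0 \<union> (\<lambda>x. inv\<^bsub>G\<^esub> x) ` S0) \<times> {..<d} \<times> {..<d})"
  have "finite X" using S0(2) by (auto simp: X_def)
  obtain a0 b0 where ab0: "a0 < d" "b0 < d" "g $$ (a0, b0) \<noteq> (1\<^sub>m d) $$ (a0, b0)"
    using eq_G[OF g(1), of "1\<^sub>m d"] g(2) one_closed by auto
  define r where "r = g $$ (a0, b0) - (1\<^sub>m d) $$ (a0, b0)"
  have "r \<noteq> 0" using ab0(3) by (simp add: r_def)
  from finite_index_separation[OF \<open>finite X\<close> this] obtain S M where
    S: "subring_set S" "X \<subseteq> S" and M: "ideal_set S M" "finite_index S M" "r \<notin> M" by blast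
  have ent: "entries_in S x" if "x \<in> C" for x
  proof -
    have "x \<in> generate G S0" using that S0(3) by simp
    then show ?thesis
    proof induction
      case one
      then show ?case using subring_setD(1,2)[OF S(1)] by (auto simp: entries_in_def)
    next
      case (incl h)
      then have "h $$ (a, b) \<in> X" if "a < d" "b < d" for a b using that unfolding X_def by force
      then show ?case using S(2) by (auto simp: entries_in_def)
    next
      case (inv h)
      then have "(inv\<^bsub>G\<^esub> h) $$ (a, b) \<in> X" if "a < d" "b < d" for a b using that unfolding X_def by force
      then show ?case using S(2) by (auto simp: entries_in_def)
    next
      case (eng h1 h2)
      then show ?case using S0(3) by (auto intro!: entries_in_mult[OF S(1)])
    qed
  qed
  obtain T where T: "T \<subseteq> S" "finite T" "\<And>s. s \<in> S \<Longrightarrow> \<exists>t\<in>T. s - t \<in> M"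
    using M(2) by (auto simp: finite_index_def)
  define U where "U = PiE ({..<d} \<times> {..<d}) (\<lambda>_. T)"
  have "finite U" unfolding U_def using T(2) by (intro finite_PiE) auto
  \<comment> \<open>A residue pattern in the finite set \<open>U\<close>. Only one direction is
    used: equal patterns make matrices congruent.\<close>
  define cl where "cl x = restrict (\<lambda>ab. SOME t. t \<in> T \<and> x $$ ab - t \<in> M) ({..<d} \<times> {..<d})" for x :: "'f mat"
  have cl: "cl x (a, b) \<in> T" "x $$ (a, b) - cl x (a, b) \<in> M" if "x \<in> C" "a < d" "b < d" for x a b
  proof -
    have "x $$ (a, b) \<in> S" using ent[OF that(1)] that by (simp add: entries_in_def)
    from T(3)[OF this] have "\<exists>t. t \<in> T \<and> x $$ (a, b) - t \<in> M" by blast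
    from someI_ex[OF this] show "cl x (a, b) \<in> T" "x $$ (a, b) - cl x (a, b) \<in> M"
      using that by (auto simp: cl_def)
  qed
  have clU: "cl x \<in> U" if "x \<in> C" for x
    unfolding U_def using cl[OF that] by (auto simp: PiE_iff) (simp add: cl_def)
  have cl_eq: "cong_mod M x y" if "x \<in> C" "y \<in> C" "cl x = cl y" for x y
    unfolding cong_mod_def
  proof (intro allI impI)
    fix a b assume ab: "a < d" "b < d"
    have "(x $$ (a, b) - cl x (a, b)) - (y $$ (a, b) - cl y (a, b)) \<in> M"
      by (rule ideal_setD(7)[OF S(1) M(1) cl(2)[OF that(1) ab] cl(2)[OF that(2) ab]])
    then show "x $$ (a, b) - y $$ (a, b) \<in> M" using that(3) by simp
  qed
  \<comment> \<open>Pigeonhole on the exponents up to \<open>card U\<close>: some \<open>l\<close>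
    with \<open>0 < l \<le> card U\<close> makes the \<open>l\<close>-th power of \<open>q\<close>
    congruent to the identity. The factorial is a multiple of every such \<open>l\<close>, hence one
    exponent for all \<open>q\<close>.\<close>
  have "cong_mod M (q [^]\<^bsub>G\<^esub> (fact (card U) :: nat)) (1\<^sub>m d)" if q: "q \<in> C" for q
  proof -
    have pow: "q [^]\<^bsub>G\<^esub> (i::nat) \<in> C" for i using nat_pow_closed[of q i] q by simp
    have "\<not> inj_on (\<lambda>i::nat. cl (q [^]\<^bsub>G\<^esub> i)) {..card U}"
    proof
      assume "inj_on (\<lambda>i::nat. cl (q [^]\<^bsub>G\<^esub> i)) {..card U}"
      then have "card {..card U} \<le> card U"
        by (rule card_inj_on_le) (use clU pow \<open>finite U\<close> in auto)
      then show False by simp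
    qed
    then obtain i j where "i \<le> card U" "j \<le> card U" "i \<noteq> j" "cl (q [^]\<^bsub>G\<^esub> i) = cl (q [^]\<^bsub>G\<^esub> j)"
      by (auto simp: inj_on_def)
    then obtain i j where ij: "i < j" "j \<le> card U" "cl (q [^]\<^bsub>G\<^esub> j) = cl (q [^]\<^bsub>G\<^esub> i)"
      by (metis nat_neq_iff)
    define l where "l = j - i"
    have l: "0 < l" "l \<le> card U" "j = i + l" using ij by (auto simp: l_def)
    let ?z = "inv\<^bsub>G\<^esub> (q [^]\<^bsub>G\<^esub> i)"
    have zC: "?z \<in> C" using inv_closed pow by auto
    have "cong_mod M (?z * (q [^]\<^bsub>G\<^esub> j)) (?z * (q [^]\<^bsub>G\<^esub> i))"
      using cl_eq[OF pow pow ij(3)] by (intro cong_mod_mult[OF S(1) M(1)] pow ent zC)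
    moreover have "?z * (q [^]\<^bsub>G\<^esub> i) = 1\<^sub>m d" using l_inv[of "q [^]\<^bsub>G\<^esub> i"] pow by simp
    moreover have "?z * (q [^]\<^bsub>G\<^esub> j) = q [^]\<^bsub>G\<^esub> l"
      using inv_solve_left'[of "q [^]\<^bsub>G\<^esub> l" "q [^]\<^bsub>G\<^esub> i" "q [^]\<^bsub>G\<^esub> j"] nat_pow_mult[of q i l] pow q l(3) by simp
    ultimately have c1: "cong_mod M (q [^]\<^bsub>G\<^esub> l) (1\<^sub>m d)" by simp
    have cm: "cong_mod M (q [^]\<^bsub>G\<^esub> (l * m)) (1\<^sub>m d)" for m
    proof (induction m)
      case 0
      then show ?case using ideal_setD(2)[OF S(1) M(1)] by (simp add: cong_mod_def)
    next
      case (Suc m)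
      have "cong_mod M (q [^]\<^bsub>G\<^esub> (l * m) * q [^]\<^bsub>G\<^esub> l) (q [^]\<^bsub>G\<^esub> (l * m) * 1\<^sub>m d)"
        using c1 one_closed by (intro cong_mod_mult[OF S(1) M(1)] pow ent) auto
      moreover have "q [^]\<^bsub>G\<^esub> (l * m) * q [^]\<^bsub>G\<^esub> l = q [^]\<^bsub>G\<^esub> (l * Suc m)"
        using nat_pow_mult[of q "l * m" l] q by (simp add: add.commute)
      moreover have "q [^]\<^bsub>G\<^esub> (l * m) * 1\<^sub>m d = q [^]\<^bsub>G\<^esub> (l * m)"
        using r_one[of "q [^]\<^bsub>G\<^esub> (l * m)"] pow by simp
      ultimately show ?case using cong_mod_trans[OF S(1) M(1)] Suc by simp
    qed
    have "l dvd fact (card U)" using l by (intro dvd_fact) auto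
    then show ?thesis using cm by (auto elim: dvdE)
  qed
  moreover have "\<not> cong_mod M g (1\<^sub>m d)" using ab0(1,2) M(3) unfolding cong_mod_def r_def by blast
  ultimately show ?thesis by (intro exI[of _ "fact (card U)"]) auto
qed

end

section \<open>First-order formulas about balls and centralizers\<close>

lemma term_val_cong: "(\<And>i. i \<in> term_vars t \<Longrightarrow> e i = e' i) \<Longrightarrow> term_val G e t = term_val G e' t"
  by (induction t) auto

lemma (in group) term_val_in: "range e \<subseteq> carrier G \<Longrightarrow> term_val G e t \<in> carrier G"
  by (induction t) auto

primrec ands :: "grp_formula list \<Rightarrow> grp_formula" where
  "ands [] = FEq TOne TOne"
| "ands (p # ps) = FAnd p (ands ps)"

lemma sat_ands [simp]: "sat G e (ands ps) \<longleftrightarrow> (\<forall>p\<in>set ps. sat G e p)"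
  by (induction ps) auto

definition ors :: "grp_formula list \<Rightarrow> grp_formula" where
  "ors ps = FNot (ands (map FNot ps))"

lemma sat_ors [simp]: "sat G e (ors ps) \<longleftrightarrow> (\<exists>p\<in>set ps. sat G e p)"
  by (auto simp: ors_def)

primrec exs :: "nat \<Rightarrow> grp_formula \<Rightarrow> grp_formula" where
  "exs 0 p = p"
| "exs (Suc n) p = exs n (FEx n p)"

lemma sat_exs:
  "sat G e (exs n p) \<longleftrightarrow> (\<exists>x. (\<forall>i<n. x i \<in> carrier G) \<and> sat G (\<lambda>i. if i < n then x i else e i) p)"
proof (induction n arbitrary: p)
  case (Suc n)
  have eq: "(\<lambda>i. if i < n then x i else e i)(n := y) = (\<lambda>i. if i < Suc n then (x(n := y)) i else e i)"
    for x y by (auto simp: less_Suc_eq)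
  show ?case
  proof
    assume "sat G e (exs (Suc n) p)"
    then obtain x y where "\<forall>i<n. x i \<in> carrier G" "y \<in> carrier G"
      "sat G ((\<lambda>i. if i < n then x i else e i)(n := y)) p" by (auto simp: Suc)
    then show "\<exists>x. (\<forall>i<Suc n. x i \<in> carrier G) \<and> sat G (\<lambda>i. if i < Suc n then x i else e i) p"
      unfolding eq by (intro exI[of _ "x(n := y)"]) (auto simp: less_Suc_eq)
  next
    assume "\<exists>x. (\<forall>i<Suc n. x i \<in> carrier G) \<and> sat G (\<lambda>i. if i < Suc n then x i else e i) p"
    then obtain x where x: "\<forall>i<Suc n. x i \<in> carrier G" "sat G (\<lambda>i. if i < Suc n then x i else e i) p" by auto
    moreover have "(\<lambda>i. if i < n then x i else e i)(n := x n) = (\<lambda>i. if i < Suc n then x i else e i)"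
      by (auto simp: less_Suc_eq)
    ultimately have "sat G ((\<lambda>i. if i < n then x i else e i)(n := x n)) p" by simp
    then show "sat G e (exs (Suc n) p)" using x(1) by (auto simp: Suc intro!: exI[of _ x])
  qed
qed auto

section \<open>Balls in the word metric of a conjugacy class, and the center of a
  centralizer\<close>

lemma prod_ball_0: "prod_ball G S 0 = {\<one>\<^bsub>G\<^esub>}"
  by (auto simp: prod_ball_def)

lemma prod_ball_Suc:
  "prod_ball G S (Suc n) = {y \<otimes>\<^bsub>G\<^esub> z | y z. y \<in> S \<union> {\<one>\<^bsub>G\<^esub>} \<and> z \<in> prod_ball G S n}"
proof (intro equalityI subsetI)
  fix x assume "x \<in> prod_ball G S (Suc n)"
  then obtain gs where gs: "length gs = Suc n" "set gs \<subseteq> S \<union> {\<one>\<^bsub>G\<^esub>}" "x = foldr (\<otimes>\<^bsub>G\<^esub>) gs \<one>\<^bsub>G\<^esub>"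
    by (auto simp: prod_ball_def)
  then obtain y hs where "gs = y # hs" by (cases gs) auto
  then show "x \<in> {y \<otimes>\<^bsub>G\<^esub> z | y z. y \<in> S \<union> {\<one>\<^bsub>G\<^esub>} \<and> z \<in> prod_ball G S n}"
    using gs by (auto simp: prod_ball_def)
next
  fix x assume "x \<in> {y \<otimes>\<^bsub>G\<^esub> z | y z. y \<in> S \<union> {\<one>\<^bsub>G\<^esub>} \<and> z \<in> prod_ball G S n}"
  then obtain y hs where "y \<in> S \<union> {\<one>\<^bsub>G\<^esub>}" "x = y \<otimes>\<^bsub>G\<^esub> foldr (\<otimes>\<^bsub>G\<^esub>) hs \<one>\<^bsub>G\<^esub>" "length hs = n"
    "set hs \<subseteq> S \<union> {\<one>\<^bsub>G\<^esub>}" by (auto simp: prod_ball_def)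
  then show "x \<in> prod_ball G S (Suc n)"
    unfolding prod_ball_def by (intro CollectI exI[of _ "y # hs"]) auto
qed

abbreviation conj_pm :: "('a, 'm) monoid_scheme \<Rightarrow> 'a \<Rightarrow> 'a set" where
  "conj_pm G h \<equiv> conj_class G h \<union> conj_class G (inv\<^bsub>G\<^esub> h)"

context group
begin

lemma conj_pm_subset: "h \<in> carrier G \<Longrightarrow> conj_pm G h \<subseteq> carrier G"
  by (auto simp: conj_class_def)

lemma prod_ball_subset: "S \<subseteq> carrier G \<Longrightarrow> prod_ball G S n \<subseteq> carrier G"
  by (induction n) (auto simp: prod_ball_0 prod_ball_Suc)

lemma conj_mult:
  "x \<in> carrier G \<Longrightarrow> y \<in> carrier G \<Longrightarrow> z \<in> carrier G \<Longrightarrow>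
    x \<otimes> (y \<otimes> z) \<otimes> inv x = (x \<otimes> y \<otimes> inv x) \<otimes> (x \<otimes> z \<otimes> inv x)"
  by (simp add: m_assoc) (simp add: m_assoc[symmetric])

lemma conj_class_conj:
  assumes "h \<in> carrier G" "x \<in> carrier G" "y \<in> conj_class G h"
  shows "x \<otimes> y \<otimes> inv x \<in> conj_class G h"
proof -
  obtain w where "w \<in> carrier G" "y = w \<otimes> h \<otimes> inv w" using assms(3) by (auto simp: conj_class_def)
  then show ?thesis using assms(1,2)
    unfolding conj_class_def
    by (intro CollectI exI[of _ "x \<otimes> w"]) (simp add: inv_mult_group m_assoc)
qed

lemma conj_class_inv:
  assumes "h \<in> carrier G" "y \<in> conj_class G h"
  shows "inv y \<in> conj_class G (inv h)"
proof -
  obtain w where "w \<in> carrier G" "y = w \<otimes> h \<otimes> inv w" using assms(2) by (auto simp: conj_class_def)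
  then show ?thesis using assms(1)
    unfolding conj_class_def
    by (intro CollectI exI[of _ "w"]) (simp add: inv_mult_group m_assoc)
qed

lemma prod_ball_add:
  assumes "S \<subseteq> carrier G" "x \<in> prod_ball G S m" "y \<in> prod_ball G S n"
  shows "x \<otimes> y \<in> prod_ball G S (m + n)"
  using assms(2)
proof (induction m arbitrary: x)
  case 0
  then show ?case using assms(3) subsetD[OF prod_ball_subset[OF assms(1)] assms(3)]
    by (simp add: prod_ball_0)
next
  case (Suc m)
  then obtain s z where sz: "s \<in> S \<union> {\<one>}" "z \<in> prod_ball G S m" "x = s \<otimes> z"
    by (auto simp: prod_ball_Suc)
  have c: "s \<in> carrier G" "z \<in> carrier G" "y \<in> carrier G"
    using sz assms prod_ball_subset[OF assms(1)] by auto
  have "s \<otimes> (z \<otimes> y) \<in> prod_ball G S (Suc (m + n))"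
    unfolding prod_ball_Suc using sz(1) Suc.IH[OF sz(2)] by blast
  then show ?case using c by (simp add: sz(3) m_assoc)
qed

lemma prod_ball_Suc_mono: "S \<subseteq> carrier G \<Longrightarrow> prod_ball G S n \<subseteq> prod_ball G S (Suc n)"
proof
  fix x assume "S \<subseteq> carrier G" "x \<in> prod_ball G S n"
  moreover from this have "x \<in> carrier G" using prod_ball_subset by blast
  ultimately show "x \<in> prod_ball G S (Suc n)"
    unfolding prod_ball_Suc by (intro CollectI exI[of _ \<one>] exI[of _ x]) auto
qed

lemma prod_ball_mono: "S \<subseteq> carrier G \<Longrightarrow> m \<le> n \<Longrightarrow> prod_ball G S m \<subseteq> prod_ball G S n"
  using lift_Suc_mono_le[of "prod_ball G S", OF prod_ball_Suc_mono] by blast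

text \<open>The balls grow strictly until they become stationary, so a ball of radius \<open>D\<close> with at
  most \<open>D\<close> elements is already the subgroup generated by \<open>S\<close>.\<close>

lemma prod_ball_stable:
  assumes S: "S \<subseteq> carrier G" and fin: "finite (prod_ball G S D)" and card: "card (prod_ball G S D) \<le> D"
  shows "prod_ball G S n \<subseteq> prod_ball G S D"
proof -
  let ?B = "prod_ball G S"
  have "\<exists>k<D. ?B (Suc k) = ?B k"
  proof (rule ccontr)
    assume "\<not> ?thesis"
    then have strict: "?B k \<subset> ?B (Suc k)" if "k < D" for k
      using that prod_ball_Suc_mono[OF S, of k] by blast
    \<comment> \<open>The ball of radius 0 already has one element, so \<open>D\<close> strict
      inclusions give more than \<open>D\<close> elements.\<close>
    have "Suc k \<le> card (?B k)" if "k \<le> D" for k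
      using that
    proof (induction k)
      case 0
      then show ?case by (simp add: prod_ball_0)
    next
      case (Suc k)
      have "finite (?B (Suc k))" using finite_subset[OF prod_ball_mono[OF S Suc.prems] fin] .
      from psubset_card_mono[OF this strict[of k]] show ?case using Suc by simp
    qed
    from this[of D] card show False by simp
  qed
  then obtain k where k: "k < D" "?B (Suc k) = ?B k" by blast
  have stat: "?B (k + j) = ?B k" for j
    by (induction j) (simp_all only: add_Suc_right add_0_right prod_ball_Suc k(2)[unfolded prod_ball_Suc])
  have "?B n \<subseteq> ?B (k + n)" by (rule prod_ball_mono[OF S]) simp
  also have "\<dots> = ?B k" by (rule stat)
  also have "\<dots> \<subseteq> ?B D" using k(1) by (intro prod_ball_mono[OF S]) simp
  finally show ?thesis .
qed

text \<open>Stability brings products of length \<open>D + D\<close> back to radius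
  \<open>D\<close>. Inverses and conjugates do not even change the radius.\<close>

lemma small_ball_normal:
  assumes h: "h \<in> carrier G" and D: "D \<ge> 1"
    and fin: "finite (prod_ball G (conj_pm G h) D)" and card: "card (prod_ball G (conj_pm G h) D) \<le> D"
  shows "prod_ball G (conj_pm G h) D \<lhd> G" "h \<in> prod_ball G (conj_pm G h) D"
proof -
  let ?S = "conj_pm G h" and ?B = "prod_ball G (conj_pm G h)"
  note S = conj_pm_subset[OF h]
  note stable = prod_ball_stable[OF S fin card]
  have Bc: "?B n \<subseteq> carrier G" for n by (rule prod_ball_subset[OF S])
  have Sinv: "inv y \<in> ?S \<union> {\<one>}" if "y \<in> ?S \<union> {\<one>}" for y
    using that conj_class_inv[OF h] conj_class_inv[of "inv h"] h by auto
  \<comment> \<open>Inversion reverses the product, so the new factor arrives on the right and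
    \<open>prod_ball_add\<close> is needed.\<close>
  have inv: "inv y \<in> ?B n" if "y \<in> ?B n" for y n
    using that
  proof (induction n arbitrary: y)
    case (Suc n)
    then obtain s z where sz: "s \<in> ?S \<union> {\<one>}" "z \<in> ?B n" "y = s \<otimes> z"
      unfolding prod_ball_Suc by blast
    have c: "s \<in> carrier G" "z \<in> carrier G" using sz S Bc[of n] by auto
    have "inv s \<otimes> \<one> \<in> ?B 1" unfolding One_nat_def prod_ball_Suc prod_ball_0 using Sinv[OF sz(1)] by blast
    then have "inv z \<otimes> inv s \<in> ?B (n + 1)"
      using Suc.IH[OF sz(2)] c by (intro prod_ball_add[OF S]) auto
    then show ?case using c by (simp add: sz(3) inv_mult_group)
  qed (simp add: prod_ball_0)
  have conj: "x \<otimes> y \<otimes> inv x \<in> ?B n" if "y \<in> ?B n" "x \<in> carrier G" for x y n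
    using that(1)
  proof (induction n arbitrary: y)
    case (Suc n)
    then obtain s z where sz: "s \<in> ?S \<union> {\<one>}" "z \<in> ?B n" "y = s \<otimes> z"
      unfolding prod_ball_Suc by blast
    have c: "s \<in> carrier G" "z \<in> carrier G" using sz S Bc[of n] by auto
    have "x \<otimes> s \<otimes> inv x \<in> ?S \<union> {\<one>}"
      using sz(1) conj_class_conj[OF h that(2)] conj_class_conj[of "inv h", OF _ that(2)] h that(2) by auto
    then have "(x \<otimes> s \<otimes> inv x) \<otimes> (x \<otimes> z \<otimes> inv x) \<in> ?B (Suc n)"
      unfolding prod_ball_Suc using Suc.IH[OF sz(2)] by blast
    then show ?case using c that(2) by (simp add: sz(3) conj_mult)
  qed (use that(2) in \<open>simp add: prod_ball_0\<close>)
  have one: "\<one> \<in> ?B D" using prod_ball_mono[OF S, of 0 D] by (auto simp: prod_ball_0)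
  have "subgroup (?B D) G"
  proof (rule subgroupI)
    show "?B D \<subseteq> carrier G" by (rule Bc)
    show "?B D \<noteq> {}" using one by blast
    show "inv y \<in> ?B D" if "y \<in> ?B D" for y using inv that .
    show "x \<otimes> y \<in> ?B D" if "x \<in> ?B D" "y \<in> ?B D" for x y
      using prod_ball_add[OF S that] stable by blast
  qed
  then show "?B D \<lhd> G" using conj by (simp add: normal_inv_iff)
  have "h \<in> conj_class G h"
    unfolding conj_class_def using h by (intro CollectI exI[of _ \<one>]) auto
  then have "h \<otimes> \<one> \<in> ?B 1" unfolding One_nat_def prod_ball_Suc prod_ball_0 by blast
  then show "h \<in> ?B D" using h stable[of 1] by auto
qed

lemma mem_center_centralizer:
  "z \<in> center_centralizer G b \<longleftrightarrow> z \<in> carrier G \<and> z \<otimes> b = b \<otimes> z \<and>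
     (\<forall>y\<in>carrier G. y \<otimes> b = b \<otimes> y \<longrightarrow> z \<otimes> y = y \<otimes> z)"
  by (auto simp: center_centralizer_def center_def centralizer_def)

lemma subgroup_center_centralizer:
  assumes b: "b \<in> carrier G"
  shows "subgroup (center_centralizer G b) G"
proof (rule subgroupI)
  show "center_centralizer G b \<subseteq> carrier G" by (auto simp: mem_center_centralizer)
  have "\<one> \<in> center_centralizer G b" using b by (simp add: mem_center_centralizer)
  then show "center_centralizer G b \<noteq> {}" by blast
next
  have inv: "inv z \<otimes> y = y \<otimes> inv z" if "z \<in> carrier G" "y \<in> carrier G" "z \<otimes> y = y \<otimes> z" for z y
  proof -
    have "inv z \<otimes> y = inv z \<otimes> (y \<otimes> z) \<otimes> inv z" using that(1,2) by (simp add: m_assoc)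
    also have "\<dots> = inv z \<otimes> (z \<otimes> y) \<otimes> inv z" using that(3) by simp
    also have "\<dots> = y \<otimes> inv z" using that(1,2) by (simp add: m_assoc[symmetric])
    finally show ?thesis .
  qed
  fix z assume "z \<in> center_centralizer G b"
  then have z: "z \<in> carrier G" "\<And>y. y \<in> carrier G \<Longrightarrow> y \<otimes> b = b \<otimes> y \<Longrightarrow> z \<otimes> y = y \<otimes> z"
    unfolding mem_center_centralizer by blast+
  show "inv z \<in> center_centralizer G b"
    unfolding mem_center_centralizer
    by (intro conjI ballI impI inv_closed inv z b refl)
next
  have mult: "z \<otimes> w \<otimes> y = y \<otimes> (z \<otimes> w)"
    if "z \<in> carrier G" "w \<in> carrier G" "y \<in> carrier G" "z \<otimes> y = y \<otimes> z" "w \<otimes> y = y \<otimes> w" for z w y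
  proof -
    have "z \<otimes> w \<otimes> y = z \<otimes> (y \<otimes> w)" using that(1-3) by (simp add: m_assoc that(5))
    also have "\<dots> = z \<otimes> y \<otimes> w" using that(1-3) by (simp add: m_assoc)
    also have "\<dots> = y \<otimes> (z \<otimes> w)" using that(1-3) by (simp add: m_assoc that(4))
    finally show ?thesis .
  qed
  fix z w assume "z \<in> center_centralizer G b" "w \<in> center_centralizer G b"
  then have z: "z \<in> carrier G" "\<And>y. y \<in> carrier G \<Longrightarrow> y \<otimes> b = b \<otimes> y \<Longrightarrow> z \<otimes> y = y \<otimes> z"
    and w: "w \<in> carrier G" "\<And>y. y \<in> carrier G \<Longrightarrow> y \<otimes> b = b \<otimes> y \<Longrightarrow> w \<otimes> y = y \<otimes> w"
    unfolding mem_center_centralizer by blast+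
  show "z \<otimes> w \<in> center_centralizer G b"
    unfolding mem_center_centralizer
    by (intro conjI ballI impI m_closed mult z w b refl)
qed

end

section \<open>First-order definitions of balls and of \<open>Z(C(b))\<close>\<close>

abbreviation comm_formula :: "nat \<Rightarrow> nat \<Rightarrow> grp_formula" where
  "comm_formula i j \<equiv> FEq (TMult (TVar i) (TVar j)) (TMult (TVar j) (TVar i))"

text \<open>Variable 1 is reserved for the element whose centralizer is meant and 2 is bound, hence
  the side condition \<open>z \<noteq> 2\<close> below.\<close>

definition cc_formula :: "nat \<Rightarrow> grp_formula" where
  "cc_formula z = FAnd (comm_formula z 1)
     (FNot (FEx 2 (FAnd (comm_formula 2 1) (FNot (comm_formula z 2)))))"

lemma (in group) sat_cc_formula:
  "z \<noteq> 2 \<Longrightarrow> e z \<in> carrier G \<Longrightarrow> sat G e (cc_formula z) \<longleftrightarrow> e z \<in> center_centralizer G (e 1)"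
  by (auto simp: cc_formula_def mem_center_centralizer)

text \<open>Variable 0 holds \<open>h\<close>; the element tested for radius \<open>k\<close> sits
  at \<open>3 * k + 3\<close>. In the step that position is \<open>3 * k + 6\<close>, split into a
  factor at \<open>3 * k + 4\<close> with conjugating element at \<open>3 * k + 5\<close> and a
  remainder at \<open>3 * k + 3\<close>. Variables 1 and 2 stay available for
  \<open>cc_formula\<close>.\<close>

primrec ball_formula :: "nat \<Rightarrow> grp_formula" where
  "ball_formula 0 = FEq (TVar 3) TOne"
| "ball_formula (Suc k) = FEx (3 * k + 3) (FEx (3 * k + 4) (FEx (3 * k + 5) (ands [
     ors [FEq (TVar (3 * k + 4)) TOne,
          FEq (TVar (3 * k + 4)) (TMult (TMult (TVar (3 * k + 5)) (TVar 0)) (TInv (TVar (3 * k + 5)))),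
          FEq (TVar (3 * k + 4)) (TMult (TMult (TVar (3 * k + 5)) (TInv (TVar 0))) (TInv (TVar (3 * k + 5))))],
     FEq (TVar (3 * k + 6)) (TMult (TVar (3 * k + 4)) (TVar (3 * k + 3))),
     ball_formula k])))"

lemma (in group) sat_ball_formula:
  assumes "e 0 \<in> carrier G"
  shows "sat G e (ball_formula k) \<longleftrightarrow> e (3 * k + 3) \<in> prod_ball G (conj_pm G (e 0)) k"
  using assms
proof (induction k arbitrary: e)
  case 0
  then show ?case by (simp add: prod_ball_0)
next
  case (Suc k)
  let ?S = "conj_pm G (e 0)"
  have Sc: "?S \<subseteq> carrier G" by (rule conj_pm_subset[OF Suc.prems])
  have "sat G e (ball_formula (Suc k)) \<longleftrightarrow> (\<exists>z\<in>carrier G. \<exists>y\<in>carrier G. \<exists>x\<in>carrier G.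
     (y = \<one> \<or> y = x \<otimes> e 0 \<otimes> inv x \<or> y = x \<otimes> inv (e 0) \<otimes> inv x) \<and>
     e (3 * Suc k + 3) = y \<otimes> z \<and> z \<in> prod_ball G ?S k)"
    using Suc by (simp add: numeral_eq_Suc)
  also have "\<dots> \<longleftrightarrow> (\<exists>y z. e (3 * Suc k + 3) = y \<otimes> z \<and> y \<in> ?S \<union> {\<one>} \<and> z \<in> prod_ball G ?S k)"
    (is "?L \<longleftrightarrow> ?R")
  proof
    assume ?L
    then show ?R unfolding conj_class_def by blast
  next
    assume ?R
    then obtain y z where yz: "e (3 * Suc k + 3) = y \<otimes> z" "y \<in> ?S \<union> {\<one>}" "z \<in> prod_ball G ?S k" by blast
    then have c: "z \<in> carrier G" "y \<in> carrier G" using prod_ball_subset[OF Sc] Sc by auto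
    moreover have "\<exists>x\<in>carrier G. y = \<one> \<or> y = x \<otimes> e 0 \<otimes> inv x \<or> y = x \<otimes> inv (e 0) \<otimes> inv x"
      using yz(2) one_closed unfolding conj_class_def by blast
    ultimately show ?L using yz by blast
  qed
  also have "\<dots> \<longleftrightarrow> e (3 * Suc k + 3) \<in> prod_ball G ?S (Suc k)"
    unfolding prod_ball_Suc by blast
  finally show ?case .
qed

primrec tpow :: "grp_term \<Rightarrow> nat \<Rightarrow> grp_term" where
  "tpow t 0 = TOne"
| "tpow t (Suc n) = TMult (tpow t n) t"

lemma (in group) term_val_tpow [simp]: "term_val G e (tpow t n) = term_val G e t [^] n"
  by (induction n) auto

section \<open>Transfer along an elementary embedding\<close>

lemma elem_embeddingD:
  assumes "elem_embedding G L f" "range e \<subseteq> carrier G"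
  shows "sat G e p \<longleftrightarrow> sat L (f \<circ> e) p"
  using assms by (auto simp: elem_embedding_def)

lemma elem_embedding_inj:
  assumes "elem_embedding G L f"
  shows "inj_on f (carrier G)"
proof (rule inj_onI)
  fix x y assume xy: "x \<in> carrier G" "y \<in> carrier G" "f x = f y"
  have "range (\<lambda>i::nat. if i = 0 then x else y) \<subseteq> carrier G" using xy by auto
  from elem_embeddingD[OF assms this, of "FEq (TVar 0) (TVar 1)"] show "x = y" using xy by simp
qed

text \<open>The exempt elements are parameters, placed from \<open>3 * D + 4\<close> on because
  \<open>ball_formula D\<close> uses variables up to \<open>3 * D + 3\<close>.\<close>

definition brenner_formula :: "nat \<Rightarrow> nat \<Rightarrow> grp_formula" where
  "brenner_formula D m = FNot (FEx 0 (FAnd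
     (ands (map (\<lambda>i. FNot (FEq (TVar 0) (TVar (3 * D + 4 + i)))) [0..<m]))
     (FNot (FEx (3 * D + 3) (ands
       [ball_formula D, FNot (FEq (TVar (3 * D + 3)) TOne), cc_formula (3 * D + 3)])))))"

lemma (in group) sat_brenner_formula:
  "sat G e (brenner_formula D m) \<longleftrightarrow> (\<forall>h\<in>carrier G. (\<forall>i<m. h \<noteq> e (3 * D + 4 + i)) \<longrightarrow>
     (\<exists>z\<in>prod_ball G (conj_pm G h) D. z \<noteq> \<one> \<and> z \<in> center_centralizer G (e 1)))"
proof -
  have ball: "sat G (e(0 := h, 3 * D + 3 := z)) (ball_formula D) \<longleftrightarrow> z \<in> prod_ball G (conj_pm G h) D"
    if "h \<in> carrier G" for h z
    using that by (subst sat_ball_formula) auto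
  have cc: "sat G (e(0 := h, 3 * D + 3 := z)) (cc_formula (3 * D + 3)) \<longleftrightarrow> z \<in> center_centralizer G (e 1)"
    if "z \<in> carrier G" for h z
    using that by (subst sat_cc_formula) auto
  have *: "(\<exists>z\<in>carrier G. z \<in> prod_ball G (conj_pm G h) D \<and> P z) \<longleftrightarrow> (\<exists>z\<in>prod_ball G (conj_pm G h) D. P z)"
    if "h \<in> carrier G" for h P
    using prod_ball_subset[OF conj_pm_subset[OF that], of D] by blast
  have "sat G e (brenner_formula D m) \<longleftrightarrow> (\<forall>h\<in>carrier G. (\<forall>i<m. h \<noteq> e (3 * D + 4 + i)) \<longrightarrow>
     (\<exists>z\<in>carrier G. z \<in> prod_ball G (conj_pm G h) D \<and> z \<noteq> \<one> \<and> z \<in> center_centralizer G (e 1)))"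
    unfolding brenner_formula_def
    by (simp add: ball cc atLeast0LessThan Ball_def[of "{..<_}"] del: One_nat_def cong: bex_cong ball_cong conj_cong)
      (intro ball_cong refl, blast)
  also have "\<dots> \<longleftrightarrow> (\<forall>h\<in>carrier G. (\<forall>i<m. h \<noteq> e (3 * D + 4 + i)) \<longrightarrow>
     (\<exists>z\<in>prod_ball G (conj_pm G h) D. z \<noteq> \<one> \<and> z \<in> center_centralizer G (e 1)))"
    by (intro ball_cong refl imp_cong *)
  finally show ?thesis .
qed

text \<open>Variables 3 and 4 are the element and its root; the representatives are parameters from
  5 on, clear of those in \<open>cc_formula\<close>.\<close>

definition power_formula :: "nat \<Rightarrow> nat \<Rightarrow> grp_formula" where
  "power_formula n m = FNot (FEx 3 (FAnd (cc_formula 3) (FNot (FEx 4 (FAnd (cc_formula 4)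
     (ors (map (\<lambda>i. FEq (TVar 3) (TMult (TVar (5 + i)) (tpow (TVar 4) n))) [0..<m])))))))"

lemma (in group) sat_power_formula:
  "sat G e (power_formula n m) \<longleftrightarrow> (\<forall>z\<in>center_centralizer G (e 1). \<exists>q\<in>center_centralizer G (e 1).
     \<exists>i<m. z = e (5 + i) \<otimes> q [^] n)"
proof -
  have "sat G (e(3 := z)) (cc_formula 3) \<longleftrightarrow> z \<in> center_centralizer G (e 1)"
    "sat G (e(3 := y, 4 := z)) (cc_formula 4) \<longleftrightarrow> z \<in> center_centralizer G (e 1)"
    if "z \<in> carrier G" for y z
    using that by (subst sat_cc_formula; simp)+
  moreover have "z \<in> center_centralizer G (e 1) \<Longrightarrow> z \<in> carrier G" for z
    by (simp add: mem_center_centralizer)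
  ultimately show ?thesis
    unfolding power_formula_def by (simp add: Ball_def Bex_def del: One_nat_def)
qed

lemma elem_embedding_closed: "elem_embedding G L f \<Longrightarrow> x \<in> carrier G \<Longrightarrow> f x \<in> carrier L"
  by (auto simp: elem_embedding_def hom_def)

lemma brenner_transfer:
  assumes "group G" "group L" and f: "elem_embedding G L f"
    and b: "b \<in> carrier G" and N: "finite N" "N \<subseteq> carrier G"
    and br: "\<And>h. h \<in> carrier G \<Longrightarrow> h \<notin> N \<Longrightarrow>
      \<exists>z\<in>prod_ball G (conj_pm G h) D. z \<noteq> \<one>\<^bsub>G\<^esub> \<and> z \<in> center_centralizer G b"
    and h: "h \<in> carrier L" "h \<notin> f ` N"
  shows "\<exists>z\<in>prod_ball L (conj_pm L h) D. z \<noteq> \<one>\<^bsub>L\<^esub> \<and> z \<in> center_centralizer L (f b)"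
proof -
  obtain ns where ns: "set ns = N" using finite_list[OF N(1)] by blast
  define v where "v = 3 * D + 4"
  \<comment> \<open>The elements of \<open>N\<close> occupy the parameter positions; the default
    \<open>b\<close> serves variable 1.\<close>
  define e where "e = (\<lambda>i. if v \<le> i \<and> i - v < length ns then ns ! (i - v) else b)"
  have e1: "e 1 = b" by (simp add: e_def v_def)
  have er: "range e \<subseteq> carrier G" using b N(2) ns by (auto simp: e_def)
  have ens: "e (v + i) = ns ! i" if "i < length ns" for i using that by (simp add: e_def)
  have "sat G e (brenner_formula D (length ns))"
    unfolding group.sat_brenner_formula[OF assms(1)] e1 v_def[symmetric]
  proof (intro ballI impI br)
    fix h assume "\<forall>i<length ns. h \<noteq> e (v + i)"
    then show "h \<notin> N" using ens ns by (metis in_set_conv_nth)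
  qed
  then have "sat L (f \<circ> e) (brenner_formula D (length ns))" using elem_embeddingD[OF f er] by blast
  moreover have "h \<noteq> (f \<circ> e) (v + i)" if "i < length ns" for i
    using h(2) ens[OF that] ns that by auto
  ultimately show ?thesis
    using h(1) unfolding group.sat_brenner_formula[OF assms(2)] v_def[symmetric]
    by (auto simp: e1 simp del: One_nat_def)
qed

lemma power_transfer:
  assumes "group G" "group L" and f: "elem_embedding G L f"
    and b: "b \<in> carrier G" and R: "finite R" "R \<subseteq> carrier G"
    and pw: "\<And>z. z \<in> center_centralizer G b \<Longrightarrow>
      \<exists>a\<in>R. \<exists>q\<in>center_centralizer G b. z = a \<otimes>\<^bsub>G\<^esub> q [^]\<^bsub>G\<^esub> (n::nat)"
    and z: "z \<in> center_centralizer L (f b)"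
  shows "\<exists>a\<in>R. \<exists>q\<in>center_centralizer L (f b). z = f a \<otimes>\<^bsub>L\<^esub> q [^]\<^bsub>L\<^esub> n"
proof -
  obtain rs where rs: "set rs = R" using finite_list[OF R(1)] by blast
  define e where "e = (\<lambda>i. if 5 \<le> i \<and> i - 5 < length rs then rs ! (i - 5) else b)"
  have e1: "e 1 = b" by (simp add: e_def)
  have er: "range e \<subseteq> carrier G" using b R(2) rs by (auto simp: e_def)
  have ers: "e (5 + i) = rs ! i" if "i < length rs" for i using that by (simp add: e_def)
  have "sat G e (power_formula n (length rs))"
    unfolding group.sat_power_formula[OF assms(1)] e1
  proof
    fix z assume "z \<in> center_centralizer G b"
    from pw[OF this] obtain a q where aq: "a \<in> R" "q \<in> center_centralizer G b"
      "z = a \<otimes>\<^bsub>G\<^esub> q [^]\<^bsub>G\<^esub> n" by blast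
    obtain i where "i < length rs" "a = rs ! i" using aq(1) rs by (auto simp: in_set_conv_nth)
    then show "\<exists>q\<in>center_centralizer G b. \<exists>i<length rs. z = e (5 + i) \<otimes>\<^bsub>G\<^esub> q [^]\<^bsub>G\<^esub> n"
      using aq ers by metis
  qed
  then have "sat L (f \<circ> e) (power_formula n (length rs))" using elem_embeddingD[OF f er] by blast
  then obtain q i where q: "q \<in> center_centralizer L (f b)" "i < length rs"
    "z = (f \<circ> e) (5 + i) \<otimes>\<^bsub>L\<^esub> q [^]\<^bsub>L\<^esub> n"
    using z unfolding group.sat_power_formula[OF assms(2)] by (auto simp: e1 simp del: One_nat_def)
  then have "z = f (rs ! i) \<otimes>\<^bsub>L\<^esub> q [^]\<^bsub>L\<^esub> n" "rs ! i \<in> R" using ers rs by auto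
  then show ?thesis using q(1) by blast
qed

section \<open>Words and homomorphisms out of a finitely generated group\<close>

lemma generate_terms:
  assumes "group L" "range l \<subseteq> carrier L" "x \<in> generate L (l ` {..<n})"
  shows "\<exists>t. term_vars t \<subseteq> {..<n} \<and> term_val L l t = x"
  using assms(3)
proof induction
  case one
  show ?case by (intro exI[of _ TOne]) auto
next
  case (incl h)
  then obtain i where "i < n" "h = l i" by auto
  then show ?case by (intro exI[of _ "TVar i"]) auto
next
  case (inv h)
  then obtain i where "i < n" "h = l i" by auto
  then show ?case by (intro exI[of _ "TInv (TVar i)"]) auto
next
  case (eng h1 h2)
  then obtain s t where "term_vars s \<subseteq> {..<n}" "term_val L l s = h1"
    "term_vars t \<subseteq> {..<n}" "term_val L l t = h2" by auto
  then show ?case by (intro exI[of _ "TMult s t"]) auto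
qed

text \<open>Von Dyck's theorem: two words for the same element differ by a relation, so the chosen
  word does not matter.\<close>

lemma word_hom:
  assumes "group L" "group G" and l: "range l \<subseteq> carrier L" "generate L (l ` {..<n}) = carrier L"
    and x: "range x \<subseteq> carrier G"
    and rel: "\<And>t. term_vars t \<subseteq> {..<n} \<Longrightarrow> term_val L l t = \<one>\<^bsub>L\<^esub> \<Longrightarrow> term_val G x t = \<one>\<^bsub>G\<^esub>"
  shows "\<exists>\<rho>\<in>hom L G. \<forall>t. term_vars t \<subseteq> {..<n} \<longrightarrow> \<rho> (term_val L l t) = term_val G x t"
proof -
  interpret L: group L by fact
  interpret G: group G by fact
  have "\<forall>y\<in>carrier L. \<exists>t. term_vars t \<subseteq> {..<n} \<and> term_val L l t = y"
    using generate_terms[OF assms(1) l(1)] l(2) by blast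
  then obtain w where w: "\<And>y. y \<in> carrier L \<Longrightarrow> term_vars (w y) \<subseteq> {..<n} \<and> term_val L l (w y) = y"
    using bchoice by metis
  define \<rho> where "\<rho> y = term_val G x (w y)" for y
  have \<rho>: "\<rho> (term_val L l t) = term_val G x t" if t: "term_vars t \<subseteq> {..<n}" for t
  proof -
    let ?s = "w (term_val L l t)"
    have s: "term_vars ?s \<subseteq> {..<n}" "term_val L l ?s = term_val L l t"
      using w L.term_val_in[OF l(1)] by auto
    have "term_val G x (TMult ?s (TInv t)) = \<one>\<^bsub>G\<^esub>"
      using s t L.term_val_in[OF l(1), of t] by (intro rel) auto
    then show ?thesis
      using G.inv_equality[of "term_val G x ?s" "inv\<^bsub>G\<^esub> (term_val G x t)"] G.term_val_in[OF x]
      by (simp add: \<rho>_def)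
  qed
  have "\<rho> \<in> hom L G"
  proof (rule homI)
    fix y assume "y \<in> carrier L"
    show "\<rho> y \<in> carrier G" unfolding \<rho>_def by (rule G.term_val_in[OF x])
  next
    fix y z assume "y \<in> carrier L" "z \<in> carrier L"
    then show "\<rho> (y \<otimes>\<^bsub>L\<^esub> z) = \<rho> y \<otimes>\<^bsub>G\<^esub> \<rho> z"
      using \<rho>[of "TMult (w y) (w z)"] w[of y] w[of z] by (simp add: \<rho>_def)
  qed
  then show ?thesis using \<rho> by blast
qed

lemma fin_gen_enum:
  assumes "group G" "fin_gen G"
  shows "\<exists>n l. range l \<subseteq> carrier G \<and> generate G (l ` {..<n::nat}) = carrier G"
proof -
  interpret group G by fact
  obtain S where S: "S \<subseteq> carrier G" "finite S" "generate G S = carrier G"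
    using assms(2) by (auto simp: fin_gen_def)
  obtain xs where xs: "set xs = S" using finite_list[OF S(2)] by blast
  let ?l = "\<lambda>i. if i < length xs then xs ! i else \<one>\<^bsub>G\<^esub>"
  have "?l ` {..<length xs} = S" unfolding xs[symmetric] by (auto simp: in_set_conv_nth)
  moreover have "range ?l \<subseteq> carrier G" using S(1) xs by auto
  ultimately show ?thesis using S(3) by (intro exI[of _ "length xs"] exI[of _ ?l]) simp
qed

lemma (in group) hom_unique_on_generate:
  assumes "group H" "g \<in> hom G H" "g' \<in> hom G H" "S \<subseteq> carrier G"
    and "\<And>s. s \<in> S \<Longrightarrow> g s = g' s" "x \<in> generate G S"
  shows "g x = g' x"
proof -
  interpret H: group H by fact
  interpret g: group_hom G H g using assms(2) by unfold_locales
  interpret g': group_hom G H g' using assms(3) by unfold_locales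
  show ?thesis
    using assms(6)
  proof induction
    case (eng h1 h2)
    then show ?case using generate_in_carrier[OF assms(4)] by simp
  qed (use assms(4,5) in auto)
qed

section \<open>Abelian groups of bounded rank\<close>

lemma (in comm_group) generate_insert_powers:
  assumes "s \<in> carrier G" "S \<subseteq> carrier G" "x \<in> generate G (insert s S)"
  shows "\<exists>i::int. \<exists>y\<in>generate G S. x = s [^] i \<otimes> y"
  using assms(3)
proof induction
  case one
  show ?case by (intro exI[of _ 0] bexI[of _ \<one>]) (auto intro: generate.one)
next
  case (incl h)
  then show ?case
  proof (cases "h = s")
    case True
    then show ?thesis using assms(1)
      by (intro exI[of _ 1] bexI[of _ \<one>]) (auto intro: generate.one simp: int_pow_1)
  next
    case False
    then have "h \<in> S" using incl by auto
    then show ?thesis using assms(2)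
      by (intro exI[of _ 0] bexI[of _ h]) (auto intro: generate.incl)
  qed
next
  case (inv h)
  then show ?case
  proof (cases "h = s")
    case True
    then show ?thesis using assms(1)
      by (intro exI[of _ "- 1"] bexI[of _ \<one>]) (auto intro: generate.one simp: int_pow_neg int_pow_1)
  next
    case False
    then have "h \<in> S" using inv by auto
    then show ?thesis using assms(2)
      by (intro exI[of _ 0] bexI[of _ "inv h"]) (auto intro: generate.inv)
  qed
next
  case (eng h1 h2)
  then obtain i j y z where *: "y \<in> generate G S" "h1 = s [^] (i::int) \<otimes> y"
    "z \<in> generate G S" "h2 = s [^] (j::int) \<otimes> z" by blast
  have c: "y \<in> carrier G" "z \<in> carrier G" using * generate_in_carrier[OF assms(2)] by auto
  have "h1 \<otimes> h2 = (s [^] i \<otimes> s [^] j) \<otimes> (y \<otimes> z)"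
    using c assms(1) by (simp add: * m_ac)
  then have "h1 \<otimes> h2 = s [^] (i + j) \<otimes> (y \<otimes> z)" using assms(1) by (simp add: int_pow_mult)
  then show ?case using * by (blast intro: generate.eng)
qed

text \<open>Each generator contributes an exponent modulo \<open>n\<close>, the rest of its exponent
  going into the \<open>n\<close>-th power. The bound depends only on the number of
  generators.\<close>

lemma (in comm_group) generate_power_reps:
  assumes n: "0 < (n::nat)" and S: "finite S" "S \<subseteq> carrier G"
  shows "\<exists>R\<subseteq>carrier G. finite R \<and> card R \<le> n ^ card S \<and>
    (\<forall>x\<in>generate G S. \<exists>y\<in>R. \<exists>q\<in>carrier G. x = y \<otimes> q [^] n)"
  using S
proof (induction S)
  case empty
  show ?case by (intro exI[of _ "{\<one>}"]) (auto simp: generate_empty intro: bexI[of _ \<one>])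
next
  case (insert s S)
  then obtain R where R: "R \<subseteq> carrier G" "finite R" "card R \<le> n ^ card S"
    "\<And>x. x \<in> generate G S \<Longrightarrow> \<exists>y\<in>R. \<exists>q\<in>carrier G. x = y \<otimes> q [^] n" by auto
  have s: "s \<in> carrier G" "S \<subseteq> carrier G" using insert by auto
  define R' where "R' = (\<lambda>(r, y). s [^] r \<otimes> y) ` ({..<n} \<times> R)"
  have "card R' \<le> card ({..<n} \<times> R)" unfolding R'_def by (rule card_image_le) (simp add: R(2))
  also have "\<dots> = n * card R" by (simp add: card_cartesian_product)
  also have "\<dots> \<le> n ^ card (insert s S)" using R(3) insert by simp
  finally have card: "card R' \<le> n ^ card (insert s S)" .
  have "\<exists>y\<in>R'. \<exists>q\<in>carrier G. x = y \<otimes> q [^] n" if x: "x \<in> generate G (insert s S)" for x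
  proof -
    obtain i :: int and z where z: "z \<in> generate G S" "x = s [^] i \<otimes> z"
      using generate_insert_powers[OF s x] by blast
    obtain y q where y: "y \<in> R" "q \<in> carrier G" "z = y \<otimes> q [^] n" using R(4)[OF z(1)] by blast
    define r where "r = nat (i mod int n)"
    have i: "i = int r + (i div int n) * int n" using n by (simp add: r_def)
    have "s [^] i = s [^] (int r + (i div int n) * int n)" using i by simp
    also have "\<dots> = s [^] r \<otimes> (s [^] (i div int n)) [^] n"
      using s(1) by (simp add: int_pow_mult int_pow_pow int_pow_int)
         (simp add: int_pow_pow flip: int_pow_int)
    finally have si: "s [^] i = s [^] r \<otimes> (s [^] (i div int n)) [^] n" .
    have yc: "y \<in> carrier G" using y R(1) by auto
    have "x = (s [^] r \<otimes> y) \<otimes> ((s [^] (i div int n)) [^] n \<otimes> q [^] n)"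
      using s(1) yc y(2) by (simp add: z(2) y(3) si m_ac)
    also have "\<dots> = (s [^] r \<otimes> y) \<otimes> (s [^] (i div int n) \<otimes> q) [^] n"
      using s(1) y(2) by (simp add: nat_pow_distrib)
    finally have "x = (s [^] r \<otimes> y) \<otimes> (s [^] (i div int n) \<otimes> q) [^] n" .
    moreover have "r < n" using n by (simp add: r_def nat_less_iff)
    then have "s [^] r \<otimes> y \<in> R'" unfolding R'_def using y(1) by force
    ultimately show ?thesis using s(1) y(2) by blast
  qed
  moreover have "R' \<subseteq> carrier G" using s(1) R(1) by (auto simp: R'_def)
  moreover have "finite R'" using R(2) by (simp add: R'_def)
  ultimately show ?case using card by blast
qed

text \<open>The group need not be finitely generated. Infinitely many classes modulo
  \<open>n\<close>-th powers would provide \<open>n ^ k + 1\<close> inequivalent elements; these lie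
  in a subgroup on at most \<open>k\<close> generators, hence in at most \<open>n ^ k\<close>
  classes.\<close>

lemma (in comm_group) bounded_rank_power_reps:
  assumes n: "0 < (n::nat)"
    and rk: "\<And>P. finite P \<Longrightarrow> P \<subseteq> carrier G \<Longrightarrow>
      \<exists>S\<subseteq>carrier G. finite S \<and> card S \<le> k \<and> P \<subseteq> generate G S"
  shows "\<exists>R\<subseteq>carrier G. finite R \<and> (\<forall>z\<in>carrier G. \<exists>a\<in>R. \<exists>q\<in>carrier G. z = a \<otimes> q [^] n)"
proof (rule ccontr)
  assume no: "\<not> ?thesis"
  have "\<exists>P\<subseteq>carrier G. finite P \<and> card P = N \<and>
      (\<forall>x\<in>P. \<forall>y\<in>P. \<forall>q\<in>carrier G. x = y \<otimes> q [^] n \<longrightarrow> x = y)" for N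
  proof (induction N)
    case 0
    show ?case by (intro exI[of _ "{}"]) auto
  next
    case (Suc N)
    then obtain P where P: "P \<subseteq> carrier G" "finite P" "card P = N"
      "\<And>x y q. x \<in> P \<Longrightarrow> y \<in> P \<Longrightarrow> q \<in> carrier G \<Longrightarrow> x = y \<otimes> q [^] n \<Longrightarrow> x = y" by blast
    obtain z where z: "z \<in> carrier G" "\<And>a q. a \<in> P \<Longrightarrow> q \<in> carrier G \<Longrightarrow> z \<noteq> a \<otimes> q [^] n"
    proof -
      have "\<not> (P \<subseteq> carrier G \<and> finite P \<and> (\<forall>z\<in>carrier G. \<exists>a\<in>P. \<exists>q\<in>carrier G. z = a \<otimes> q [^] n))"
        using no by (rule contrapos_nn) (rule exI)
      then show ?thesis using P(1,2) that by auto
    qed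
    have z': "a \<noteq> z \<otimes> q [^] n" if "a \<in> P" "q \<in> carrier G" for a q
    proof
      assume "a = z \<otimes> q [^] n"
      then have "z = a \<otimes> inv q [^] n" using z(1) that(2) by (simp add: m_assoc nat_pow_inv)
      then show False using z(2)[OF that(1), of "inv q"] that(2) by simp
    qed
    have "z \<notin> P" using z(2)[of z \<one>] z(1) by auto
    then have "card (insert z P) = Suc N" using P by simp
    moreover have "x = y" if "x \<in> insert z P" "y \<in> insert z P" "q \<in> carrier G" "x = y \<otimes> q [^] n" for x y q
      using that z(2)[of y q] z'[of x q] P(4)[of x y q] by auto
    ultimately show ?case using P(1,2) z(1) by (intro exI[of _ "insert z P"]) blast
  qed
  from this[of "Suc (n ^ k)"] obtain P where P: "P \<subseteq> carrier G" "finite P" "card P = Suc (n ^ k)"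
    "\<And>x y q. x \<in> P \<Longrightarrow> y \<in> P \<Longrightarrow> q \<in> carrier G \<Longrightarrow> x = y \<otimes> q [^] n \<Longrightarrow> x = y" by blast
  obtain S where S: "S \<subseteq> carrier G" "finite S" "card S \<le> k" "P \<subseteq> generate G S" using rk[OF P(2,1)] by blast
  obtain R where R: "R \<subseteq> carrier G" "finite R" "card R \<le> n ^ card S"
    "\<And>x. x \<in> generate G S \<Longrightarrow> \<exists>y\<in>R. \<exists>q\<in>carrier G. x = y \<otimes> q [^] n"
    using generate_power_reps[OF n S(2,1)] by auto
  have "\<forall>x\<in>P. \<exists>y. y \<in> R \<and> (\<exists>q\<in>carrier G. x = y \<otimes> q [^] n)" using R(4) S(4) by blast
  from bchoice[OF this] obtain g where
    g: "\<And>x. x \<in> P \<Longrightarrow> g x \<in> R \<and> (\<exists>q\<in>carrier G. x = g x \<otimes> q [^] n)" by blast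
  have "inj_on g P"
  proof (rule inj_onI)
    fix x y assume xy: "x \<in> P" "y \<in> P" "g x = g y"
    obtain q where q: "q \<in> carrier G" "x = g y \<otimes> q [^] n" using g[OF xy(1)] xy(3) by auto
    obtain p where p: "p \<in> carrier G" "y = g y \<otimes> p [^] n" using g[OF xy(2)] by auto
    have c: "g y \<in> carrier G" using g[OF xy(2)] R(1) by auto
    have "y \<otimes> (inv p \<otimes> q) [^] n = (g y \<otimes> p [^] n) \<otimes> (inv (p [^] n) \<otimes> q [^] n)"
      using p(1) q(1) by (subst p(2)) (simp add: nat_pow_distrib nat_pow_inv)
    also have "\<dots> = g y \<otimes> (p [^] n \<otimes> (inv (p [^] n) \<otimes> q [^] n))"
      using c p(1) q(1) by (simp add: m_assoc)
    also have "p [^] n \<otimes> (inv (p [^] n) \<otimes> q [^] n) = q [^] n"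
      using p(1) q(1) by (simp add: m_assoc[symmetric])
    also have "g y \<otimes> q [^] n = x" by (rule q(2)[symmetric])
    finally show "x = y" using P(4)[OF xy(1,2), of "inv p \<otimes> q"] p(1) q(1) by simp
  qed
  then have "card P \<le> card R" using g R(2) by (intro card_inj_on_le[of g]) auto
  moreover have "n ^ card S \<le> n ^ k" using n S(3) by (intro power_increasing) auto
  ultimately show False using P(3) R(3) by simp
qed

context group
begin

lemma comm_group_center_centralizer:
  assumes "b \<in> carrier G"
  shows "comm_group (G\<lparr>carrier := center_centralizer G b\<rparr>)"
proof -
  interpret K: group "G\<lparr>carrier := center_centralizer G b\<rparr>"
    by (rule subgroup.subgroup_is_group[OF subgroup_center_centralizer[OF assms] is_group])
  show ?thesis
  proof (rule K.group_comm_groupI)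
    fix x y assume "x \<in> carrier (G\<lparr>carrier := center_centralizer G b\<rparr>)"
      "y \<in> carrier (G\<lparr>carrier := center_centralizer G b\<rparr>)"
    then have "x \<in> center_centralizer G b" "y \<in> center_centralizer G b" by simp_all
    then have "x \<otimes> y = y \<otimes> x" unfolding mem_center_centralizer by blast
    then show "x \<otimes>\<^bsub>G\<lparr>carrier := center_centralizer G b\<rparr>\<^esub> y = y \<otimes>\<^bsub>G\<lparr>carrier := center_centralizer G b\<rparr>\<^esub> x"
      by simp
  qed
qed

lemma center_centralizer_power_reps:
  assumes b: "b \<in> carrier G" and n: "0 < (n::nat)"
    and rk: "\<forall>H. subgroup H G \<and> H \<subseteq> center_centralizer G b \<and> fin_gen (G\<lparr>carrier := H\<rparr>) \<longrightarrow>
        min_gens (G\<lparr>carrier := H\<rparr>) \<le> k"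
  shows "\<exists>R\<subseteq>center_centralizer G b. finite R \<and>
    (\<forall>z\<in>center_centralizer G b. \<exists>a\<in>R. \<exists>q\<in>center_centralizer G b. z = a \<otimes> q [^] n)"
proof -
  let ?A = "center_centralizer G b"
  let ?K = "G\<lparr>carrier := ?A\<rparr>"
  interpret K: comm_group ?K by (rule comm_group_center_centralizer[OF b])
  have A: "subgroup ?A G" by (rule subgroup_center_centralizer[OF b])
  have Ac: "?A \<subseteq> carrier G" by (rule subgroup.subset[OF A])
  have "\<exists>S\<subseteq>?A. finite S \<and> card S \<le> k \<and> P \<subseteq> generate ?K S" if P: "finite P" "P \<subseteq> ?A" for P
  proof -
    let ?H = "generate G P" and ?Q = "\<lambda>H n. \<exists>S\<subseteq>H. finite S \<and> card S = n \<and> generate (G\<lparr>carrier := H\<rparr>) S = H"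
    have Pc: "P \<subseteq> carrier G" using P(2) Ac by simp
    have H: "subgroup ?H G" by (rule generate_is_subgroup[OF Pc])
    have HA: "?H \<subseteq> ?A" by (rule generate_subgroup_incl[OF P(2) A])
    have PH: "P \<subseteq> ?H" by (auto intro: generate.incl)
    have gen: "generate (G\<lparr>carrier := ?H\<rparr>) P = ?H" using generate_consistent[OF PH H] by simp
    then have fg: "fin_gen (G\<lparr>carrier := ?H\<rparr>)"
      using P(1) PH unfolding fin_gen_def by auto
    \<comment> \<open>\<open>P\<close> shows that some generating number exists, so the least one is
      attained and yields the set \<open>S\<close>.\<close>
    have "?Q ?H (card P)" using gen P(1) PH by blast
    then have "?Q ?H (LEAST n. ?Q ?H n)" by (rule LeastI)
    then have "?Q ?H (min_gens (G\<lparr>carrier := ?H\<rparr>))" by (simp add: min_gens_def)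
    then obtain S where S: "S \<subseteq> ?H" "finite S" "card S = min_gens (G\<lparr>carrier := ?H\<rparr>)"
      "generate (G\<lparr>carrier := ?H\<rparr>) S = ?H" by blast
    have SA: "S \<subseteq> ?A" using S(1) HA by blast
    have "generate ?K S = generate G S" by (rule generate_consistent[OF SA A])
    also have "\<dots> = generate (G\<lparr>carrier := ?H\<rparr>) S" by (rule generate_consistent[OF S(1) H, symmetric])
    finally have "P \<subseteq> generate ?K S" using PH S(4) by simp
    moreover have "card S \<le> k" using rk H HA fg S(3) by auto
    ultimately show ?thesis using SA S(2) by blast
  qed
  from K.bounded_rank_power_reps[OF n, of k] this show ?thesis
    by (simp add: nat_pow_consistent[symmetric])
qed

end

section \<open>Elementary extensions of linear groups\<close>

context linear_group
begin

text \<open>The generators of \<open>L\<close> become unknowns. Besides the relations, the words for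
  the images of the generators \<open>y i\<close> must take the values \<open>y i\<close>, which
  makes the map a retraction, and the word for \<open>h\<close> must not vanish. In \<open>L\<close>
  the tuple \<open>l\<close> is a solution.\<close>

lemma separating_retraction:
  assumes fgG: "fin_gen G" and L: "group L" "fin_gen L" and f: "elem_embedding G L f"
    and h: "h \<in> carrier L" "h \<noteq> \<one>\<^bsub>L\<^esub>"
  shows "\<exists>\<rho>\<in>hom L G. (\<forall>x\<in>C. \<rho> (f x) = x) \<and> \<rho> h \<noteq> \<one>\<^bsub>G\<^esub>"
proof -
  interpret L: group L by fact
  obtain n l where l: "range l \<subseteq> carrier L" "generate L (l ` {..<n::nat}) = carrier L"
    using fin_gen_enum[OF L] by blast
  obtain m y where y: "range y \<subseteq> carrier G" "generate G (y ` {..<m::nat}) = carrier G"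
    using fin_gen_enum[OF is_group fgG] by blast
  have terms: "\<exists>t. term_vars t \<subseteq> {..<n} \<and> term_val L l t = z" if "z \<in> carrier L" for z
    using generate_terms[OF L(1) l(1), of z n] that l(2) by simp
  have "\<forall>i. \<exists>t. term_vars t \<subseteq> {..<n} \<and> term_val L l t = f (y i)"
    using terms elem_embedding_closed[OF f] y(1) by blast
  then obtain w where w: "\<And>i. term_vars (w i) \<subseteq> {..<n}" "\<And>i. term_val L l (w i) = f (y i)" by metis
  obtain u where u: "term_vars u \<subseteq> {..<n}" "term_val L l u = h" using terms[OF h(1)] by blast
  define W where "W = {t. term_vars t \<subseteq> {..<n} \<and> term_val L l t = \<one>\<^bsub>L\<^esub>}"
  obtain W0 where W0: "W0 \<subseteq> W" "finite W0" "\<And>e t. range e \<subseteq> C \<Longrightarrow>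
     (\<forall>t\<in>W0. term_val G e t = \<one>\<^bsub>G\<^esub>) \<Longrightarrow> t \<in> W \<Longrightarrow> term_val G e t = \<one>\<^bsub>G\<^esub>"
    using equationally_noetherian[of W n] by (auto simp: W_def)
  obtain ws where ws: "set ws = W0" using finite_list[OF W0(2)] by blast
  define p where "p = exs n (ands (map (\<lambda>t. FEq t TOne) ws @
     map (\<lambda>i. FEq (w i) (TVar (n + i))) [0..<m] @ [FNot (FEq u TOne)]))"
  \<comment> \<open>Parameters start at \<open>n\<close>. Below \<open>n\<close> truncated
    subtraction yields \<open>y 0\<close>, which the quantifiers of \<open>exs\<close>
    override.\<close>
  define e where "e i = y (i - n)" for i
  have er: "range e \<subseteq> carrier G" using y(1) by (auto simp: e_def)
  have "sat L (f \<circ> e) p"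
    unfolding p_def sat_exs
  proof (intro exI[of _ l] conjI allI impI)
    show "l i \<in> carrier L" for i using l(1) by auto
    have "term_val L (\<lambda>i. if i < n then l i else (f \<circ> e) i) t = term_val L l t"
      if "term_vars t \<subseteq> {..<n}" for t
      using that by (intro term_val_cong) auto
    note c = this
    show "sat L (\<lambda>i. if i < n then l i else (f \<circ> e) i) (ands (map (\<lambda>t. FEq t TOne) ws @
       map (\<lambda>i. FEq (w i) (TVar (n + i))) [0..<m] @ [FNot (FEq u TOne)]))"
      using c[OF w(1)] w(2) c[OF u(1)] u(2) h(2) c W0(1) ws by (auto simp: e_def W_def)
  qed
  then have "sat G e p" using elem_embeddingD[OF f er] by blast
  then obtain x where x: "\<And>i. i < n \<Longrightarrow> x i \<in> carrier G" and
    sx: "sat G (\<lambda>i. if i < n then x i else e i) (ands (map (\<lambda>t. FEq t TOne) ws @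
       map (\<lambda>i. FEq (w i) (TVar (n + i))) [0..<m] @ [FNot (FEq u TOne)]))"
    unfolding p_def sat_exs by blast
  define e2 where "e2 = (\<lambda>i. if i < n then x i else e i)"
  have e2: "range e2 \<subseteq> carrier G" using x er by (auto simp: e2_def)
  have e2n: "e2 (n + i) = y i" for i by (simp add: e2_def e_def)
  have s1: "\<forall>t\<in>W0. term_val G e2 t = \<one>\<^bsub>G\<^esub>" and s2: "\<And>i. i < m \<Longrightarrow> term_val G e2 (w i) = y i"
    and s3: "term_val G e2 u \<noteq> \<one>\<^bsub>G\<^esub>"
    using sx unfolding e2_def[symmetric] sat_ands set_append ball_Un set_map ball_simps
    by (simp_all add: ws e2n)
  \<comment> \<open>The solution is known to satisfy only \<open>W0\<close>; by the choice of
    \<open>W0\<close> it satisfies all relations, as \<open>word_hom\<close> requires.\<close>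
  have "\<exists>\<rho>\<in>hom L G. \<forall>t. term_vars t \<subseteq> {..<n} \<longrightarrow> \<rho> (term_val L l t) = term_val G e2 t"
    using W0(3)[OF _ s1] e2 by (intro word_hom L is_group l) (auto simp: W_def)
  then obtain \<rho> where \<rho>: "\<rho> \<in> hom L G"
    "\<And>t. term_vars t \<subseteq> {..<n} \<Longrightarrow> \<rho> (term_val L l t) = term_val G e2 t" by blast
  have "\<rho> (f x) = x" if "x \<in> C" for x
  proof -
    have fh: "f \<in> hom G L" using f by (simp add: elem_embedding_def)
    have "(\<rho> \<circ> f) x = id x"
    proof (rule hom_unique_on_generate[where H = G and S = "y ` {..<m}" and g = "\<rho> \<circ> f" and g' = id])
      show "group G" by (rule is_group)
      show "\<rho> \<circ> f \<in> hom G G" using fh \<rho>(1) by (rule Group.hom_compose)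
      show "id \<in> hom G G" by (simp add: hom_def)
      show "y ` {..<m} \<subseteq> carrier G" using y(1) by auto
      show "x \<in> generate G (y ` {..<m})" using that y(2) by simp
      show "(\<rho> \<circ> f) s = id s" if "s \<in> y ` {..<m}" for s
        using that \<rho>(2)[OF w(1)] w(2) s2 by auto
    qed
    then show ?thesis by simp
  qed
  moreover have "\<rho> h \<noteq> \<one>\<^bsub>G\<^esub>" using \<rho>(2)[OF u(1)] u(2) s3 by simp
  ultimately show ?thesis using \<rho>(1) by blast
qed

lemma elem_embedding_onto:
  assumes fgG: "fin_gen G" and L: "group L" "fin_gen L" and f: "elem_embedding G L f"
    and br: "brenner G b"
    and N: "finite N" "N \<subseteq> carrier G" "\<And>M. M \<lhd> G \<Longrightarrow> finite M \<Longrightarrow> M \<subseteq> N"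
    and rk: "\<forall>H. subgroup H G \<and> H \<subseteq> center_centralizer G b \<and> fin_gen (G\<lparr>carrier := H\<rparr>) \<longrightarrow>
        min_gens (G\<lparr>carrier := H\<rparr>) \<le> k"
  shows "f ` carrier G = carrier L"
proof (rule ccontr)
  assume "f ` carrier G \<noteq> carrier L"
  then obtain y where y: "y \<in> carrier L" "y \<notin> f ` carrier G"
    using elem_embedding_closed[OF f] by blast
  interpret L: group L by fact
  note fc = elem_embedding_closed[OF f]
  have fh: "f \<in> hom G L" using f by (simp add: elem_embedding_def)
  interpret f: group_hom G L f using fh by unfold_locales
  obtain D where b: "b \<in> carrier G" and D: "D \<ge> 1"
    and D': "\<And>h. h \<in> carrier G \<Longrightarrow> infinite (prod_ball G (conj_pm G h) D) \<or> card (prod_ball G (conj_pm G h) D) > D \<Longrightarrow>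
       prod_ball G (conj_pm G h) D \<inter> center_centralizer G b \<noteq> {\<one>\<^bsub>G\<^esub>}"
    using br unfolding brenner_def Let_def by blast
  have brG: "\<exists>z\<in>prod_ball G (conj_pm G h) D. z \<noteq> \<one>\<^bsub>G\<^esub> \<and> z \<in> center_centralizer G b"
    if h: "h \<in> carrier G" "h \<notin> N" for h
  proof -
    let ?B = "prod_ball G (conj_pm G h) D"
    have "\<not> (finite ?B \<and> card ?B \<le> D)"
      using small_ball_normal[OF h(1) D] N(3)[of ?B] h(2) by blast
    then have "?B \<inter> center_centralizer G b \<noteq> {\<one>\<^bsub>G\<^esub>}" using D'[OF h(1)] by auto
    moreover have "\<one>\<^bsub>G\<^esub> \<in> ?B"
      using prod_ball_mono[OF conj_pm_subset[OF h(1)], of 0 D] by (auto simp: prod_ball_0)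
    moreover have "\<one>\<^bsub>G\<^esub> \<in> center_centralizer G b"
      by (rule subgroup.one_closed[OF subgroup_center_centralizer[OF b]])
    ultimately show ?thesis by blast
  qed
  \<comment> \<open>Any nontrivial element will do for the first retraction; one exists because
    \<open>f\<close> is not onto.\<close>
  obtain h0 where "h0 \<in> carrier L" "h0 \<noteq> \<one>\<^bsub>L\<^esub>" using y f.one_closed fc by (metis f.hom_one imageI one_closed)
  with separating_retraction[OF fgG L f] obtain \<rho> where \<rho>: "\<rho> \<in> hom L G" "\<And>x. x \<in> C \<Longrightarrow> \<rho> (f x) = x" by blast
  interpret \<rho>: group_hom L G \<rho> using \<rho>(1) by unfold_locales
  \<comment> \<open>The quotient of \<open>y\<close> by its retract lies in the kernel, and it is
    nontrivial because \<open>y\<close> is outside the image of \<open>f\<close>.\<close>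
  define h where "h = y \<otimes>\<^bsub>L\<^esub> inv\<^bsub>L\<^esub> (f (\<rho> y))"
  have \<rho>y: "\<rho> y \<in> carrier G" "f (\<rho> y) \<in> carrier L" using y(1) fc \<rho>.hom_closed by auto
  have h: "h \<in> carrier L" using y(1) \<rho>y by (simp add: h_def)
  have h1: "h \<noteq> \<one>\<^bsub>L\<^esub>"
  proof
    assume "h = \<one>\<^bsub>L\<^esub>"
    then have "y = f (\<rho> y)" using y(1) \<rho>y L.inv_equality[of y "inv\<^bsub>L\<^esub> f (\<rho> y)"] by (simp add: h_def)
    then show False using y(2) \<rho>y(1) by blast
  qed
  have \<rho>h: "\<rho> h = \<one>\<^bsub>G\<^esub>"
    using y(1) \<rho>y \<rho>(2)[of "\<rho> y"] r_inv[of "\<rho> y"] unfolding h_def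
    by (simp del: mult_G one_G add: \<rho>.hom_mult)
  have "h \<notin> f ` N"
  proof
    assume "h \<in> f ` N"
    then obtain x where "x \<in> C" "h = f x" using N(2) by auto
    then show False using \<rho>(2)[of x] \<rho>h h1 f.hom_one by auto
  qed
  from brenner_transfer[OF is_group L(1) f b N(1,2) brG h this]
  obtain z where z: "z \<in> prod_ball L (conj_pm L h) D" "z \<noteq> \<one>\<^bsub>L\<^esub>" "z \<in> center_centralizer L (f b)" by blast
  have cz: "z \<in> carrier L" using z(3) by (simp add: L.mem_center_centralizer)
  \<comment> \<open>The kernel is normal, so it contains the whole ball around conjugates of
    \<open>h\<close> and its inverse.\<close>
  have \<rho>z: "\<rho> z = \<one>\<^bsub>G\<^esub>"
  proof -
    have k: "\<rho> s = \<one>\<^bsub>G\<^esub> \<and> s \<in> carrier L" if s: "s \<in> conj_pm L h \<union> {\<one>\<^bsub>L\<^esub>}" for s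
    proof -
      have conj: "\<rho> (x \<otimes>\<^bsub>L\<^esub> g \<otimes>\<^bsub>L\<^esub> inv\<^bsub>L\<^esub> x) = \<one>\<^bsub>G\<^esub>"
        if "\<rho> g = \<one>\<^bsub>G\<^esub>" "g \<in> carrier L" "x \<in> carrier L" for g x
        using that \<rho>.hom_closed[of x] r_inv[of "\<rho> x"] by (simp del: mult_G one_G add: \<rho>.hom_mult)
      have "\<rho> (inv\<^bsub>L\<^esub> h) = \<one>\<^bsub>G\<^esub>" using h \<rho>h by (simp del: one_G)
      then show ?thesis using s h \<rho>h conj[of h] conj[of "inv\<^bsub>L\<^esub> h"] L.conj_pm_subset[OF h] \<rho>.hom_one
        by (auto simp: conj_class_def simp del: one_G)
    qed
    have "\<rho> w = \<one>\<^bsub>G\<^esub> \<and> w \<in> carrier L" if "w \<in> prod_ball L (conj_pm L h) n" for w n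
      using that
    proof (induction n arbitrary: w)
      case (Suc n)
      then obtain s v where "s \<in> conj_pm L h \<union> {\<one>\<^bsub>L\<^esub>}" "v \<in> prod_ball L (conj_pm L h) n" "w = s \<otimes>\<^bsub>L\<^esub> v"
        unfolding prod_ball_Suc by blast
      then show ?case using k[of s] Suc.IH[of v] l_one[OF one_closed] by (simp add: \<rho>.hom_mult del: one_G mult_G)
    qed (simp add: prod_ball_0 \<rho>.hom_one del: one_G)
    then show ?thesis using z(1) by blast
  qed
  obtain \<rho>' where \<rho>': "\<rho>' \<in> hom L G" "\<rho>' z \<noteq> \<one>\<^bsub>G\<^esub>"
    using separating_retraction[OF fgG L f cz z(2)] by blast
  interpret \<rho>': group_hom L G \<rho>' using \<rho>'(1) by unfold_locales
  obtain n :: nat where n: "n > 0" "\<And>q. q \<in> C \<Longrightarrow> q [^]\<^bsub>G\<^esub> n \<noteq> \<rho>' z"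
    using ex_non_power[OF fgG _ \<rho>'(2)] \<rho>'.hom_closed[OF cz] by auto
  obtain R where R: "R \<subseteq> center_centralizer G b" "finite R"
    "\<And>z. z \<in> center_centralizer G b \<Longrightarrow> \<exists>a\<in>R. \<exists>q\<in>center_centralizer G b. z = a \<otimes>\<^bsub>G\<^esub> q [^]\<^bsub>G\<^esub> n"
    using center_centralizer_power_reps[OF b n(1) rk] by blast
  have Rc: "R \<subseteq> carrier G" using R(1) mem_center_centralizer by blast
  obtain a q where a: "a \<in> carrier G" and q: "q \<in> center_centralizer L (f b)"
    and zq: "z = f a \<otimes>\<^bsub>L\<^esub> q [^]\<^bsub>L\<^esub> n"
    using power_transfer[OF is_group L(1) f b R(2) Rc R(3) z(3)] Rc by blast
  have qc: "q \<in> carrier L" and qb: "q \<otimes>\<^bsub>L\<^esub> f b = f b \<otimes>\<^bsub>L\<^esub> q"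
    and qq: "\<And>y. y \<in> carrier L \<Longrightarrow> y \<otimes>\<^bsub>L\<^esub> f b = f b \<otimes>\<^bsub>L\<^esub> y \<Longrightarrow> q \<otimes>\<^bsub>L\<^esub> y = y \<otimes>\<^bsub>L\<^esub> q"
    using q unfolding L.mem_center_centralizer by blast+
  \<comment> \<open>\<open>\<rho> q\<close> centralizes \<open>b\<close>, so \<open>?r\<close>
    centralizes \<open>f b\<close>, and \<open>q\<close>, central in that centralizer, commutes with
    \<open>?r\<close>. Applying \<open>\<rho>\<close> to \<open>zq\<close> shows that
    \<open>f a\<close> is the \<open>n\<close>-th power of the inverse of \<open>?r\<close>; hence
    \<open>z\<close> is the \<open>n\<close>-th power of \<open>inv ?r * q\<close>.\<close>
  let ?r = "f (\<rho> q)"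
  have \<rho>q: "\<rho> q \<in> carrier G" by (rule \<rho>.hom_closed[OF qc])
  have rc: "?r \<in> carrier L" by (rule fc[OF \<rho>q])
  have "\<rho> q \<otimes>\<^bsub>G\<^esub> b = b \<otimes>\<^bsub>G\<^esub> \<rho> q"
    using arg_cong[OF qb, of \<rho>] \<rho>(2)[of b] b qc fc[OF b] by (simp add: \<rho>.hom_mult del: mult_G)
  then have "?r \<otimes>\<^bsub>L\<^esub> f b = f b \<otimes>\<^bsub>L\<^esub> ?r" using b \<rho>q by (metis f.hom_mult)
  then have comm: "q \<otimes>\<^bsub>L\<^esub> ?r = ?r \<otimes>\<^bsub>L\<^esub> q" using qq rc by blast
  have "\<one>\<^bsub>G\<^esub> = a \<otimes>\<^bsub>G\<^esub> \<rho> q [^]\<^bsub>G\<^esub> n"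
    using \<rho>z \<rho>(2)[of a] a qc fc[OF a] unfolding zq
    by (simp add: \<rho>.hom_mult \<rho>.hom_nat_pow del: mult_G one_G)
  then have "a = inv\<^bsub>G\<^esub> (\<rho> q [^]\<^bsub>G\<^esub> n)"
    using a \<rho>q inv_equality[of a "\<rho> q [^]\<^bsub>G\<^esub> n"] nat_pow_closed[of "\<rho> q" n] by metis
  then have fa: "f a = inv\<^bsub>L\<^esub> ?r [^]\<^bsub>L\<^esub> n"
    using \<rho>q nat_pow_closed[of "\<rho> q" n] rc by (simp add: f.hom_nat_pow L.nat_pow_inv del: carrier_G)
  have "inv\<^bsub>L\<^esub> ?r \<otimes>\<^bsub>L\<^esub> q = q \<otimes>\<^bsub>L\<^esub> inv\<^bsub>L\<^esub> ?r"
  proof -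
    have "inv\<^bsub>L\<^esub> ?r \<otimes>\<^bsub>L\<^esub> q = inv\<^bsub>L\<^esub> ?r \<otimes>\<^bsub>L\<^esub> (q \<otimes>\<^bsub>L\<^esub> ?r) \<otimes>\<^bsub>L\<^esub> inv\<^bsub>L\<^esub> ?r"
      using qc rc by (simp add: L.m_assoc)
    also have "\<dots> = inv\<^bsub>L\<^esub> ?r \<otimes>\<^bsub>L\<^esub> (?r \<otimes>\<^bsub>L\<^esub> q) \<otimes>\<^bsub>L\<^esub> inv\<^bsub>L\<^esub> ?r" by (simp only: comm)
    also have "\<dots> = q \<otimes>\<^bsub>L\<^esub> inv\<^bsub>L\<^esub> ?r" using qc rc by (simp add: L.m_assoc[symmetric])
    finally show ?thesis .
  qed
  then have "(inv\<^bsub>L\<^esub> ?r \<otimes>\<^bsub>L\<^esub> q) [^]\<^bsub>L\<^esub> n = inv\<^bsub>L\<^esub> ?r [^]\<^bsub>L\<^esub> n \<otimes>\<^bsub>L\<^esub> q [^]\<^bsub>L\<^esub> n"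
    using qc rc by (intro L.pow_mult_distrib) auto
  then have zpow: "z = (inv\<^bsub>L\<^esub> ?r \<otimes>\<^bsub>L\<^esub> q) [^]\<^bsub>L\<^esub> n" by (simp add: zq fa)
  define s where "s = inv\<^bsub>L\<^esub> ?r \<otimes>\<^bsub>L\<^esub> q"
  have sc: "s \<in> carrier L" using qc rc by (simp add: s_def)
  have "\<rho>' z = \<rho>' s [^]\<^bsub>G\<^esub> n" unfolding zpow s_def[symmetric] by (rule \<rho>'.hom_nat_pow[OF sc])
  moreover have "\<rho>' s \<in> C" using \<rho>'.hom_closed[OF sc] by simp
  ultimately show False using n(2) by metis
qed

end

section \<open>Reduction to countable carriers\<close>

instance grp_term :: countable
  by countable_datatype

text \<open>Every element is the value of a term, and there are countably many terms.\<close>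

lemma countable_fin_gen:
  assumes "group L" "fin_gen L"
  shows "countable (carrier L)"
proof -
  obtain n l where l: "range l \<subseteq> carrier L" "generate L (l ` {..<n::nat}) = carrier L"
    using fin_gen_enum[OF assms] by blast
  have "carrier L \<subseteq> range (term_val L l)"
    using generate_terms[OF assms(1) l(1), of _ n] l(2) by blast
  then show ?thesis by (rule countable_subset) simp
qed

lemma sat_iso:
  assumes "group L" "group K" and h: "h \<in> iso L K" and "range e \<subseteq> carrier L"
  shows "sat L e p \<longleftrightarrow> sat K (h \<circ> e) p"
  using assms(4)
proof (induction p arbitrary: e)
  interpret L: group L by fact
  interpret K: group K by fact
  interpret h: group_hom L K h using h by unfold_locales (simp add: iso_def)
  have inj: "inj_on h (carrier L)" and onto: "h ` carrier L = carrier K"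
    using h by (auto simp: iso_def bij_betw_def)
  have tv: "h (term_val L e t) = term_val K (h \<circ> e) t" if e: "range e \<subseteq> carrier L" for e t
    by (induction t) (use L.term_val_in[OF e] in auto)
  {
    case (FEq s t)
    show ?case
      unfolding sat.simps tv[OF FEq, symmetric]
      using inj_on_eq_iff[OF inj L.term_val_in[OF FEq] L.term_val_in[OF FEq]] by auto
  next
    case (FEx i p)
    have upd: "h \<circ> e(i := x) = (h \<circ> e)(i := h x)" for x by auto
    have "sat L (e(i := x)) p \<longleftrightarrow> sat K ((h \<circ> e)(i := h x)) p" if "x \<in> carrier L" for x
      unfolding upd[symmetric] by (rule FEx.IH) (use FEx.prems that in auto)
    then show ?case unfolding sat.simps onto[symmetric] by blast
  }
qed auto

lemma elem_equiv_iso: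
  assumes "group L" "group K" "h \<in> iso L K" "elem_equiv L G"
  shows "elem_equiv K G"
proof -
  have onto: "h ` carrier L = carrier K" using assms(3) by (auto simp: iso_def bij_betw_def)
  have "holds L p \<longleftrightarrow> holds K p" for p
    unfolding holds_def
  proof (intro iffI allI impI)
    fix e :: "nat \<Rightarrow> _" assume *: "\<forall>e. range e \<subseteq> carrier L \<longrightarrow> sat L e p" and e: "range e \<subseteq> carrier K"
    have e': "range (inv_into (carrier L) h \<circ> e) \<subseteq> carrier L"
      using e onto inv_into_into[of _ h "carrier L"] by (auto simp: image_subset_iff)
    moreover have "h \<circ> (inv_into (carrier L) h \<circ> e) = e"
      using e onto f_inv_into_f[of _ h "carrier L"] by (auto simp: fun_eq_iff image_subset_iff)
    ultimately show "sat K e p" using sat_iso[OF assms(1-3) e', of p] * by simp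
  next
    fix e :: "nat \<Rightarrow> _" assume *: "\<forall>e. range e \<subseteq> carrier K \<longrightarrow> sat K e p" and e: "range e \<subseteq> carrier L"
    have "range (h \<circ> e) \<subseteq> carrier K" using e onto by auto
    then show "sat L e p" using sat_iso[OF assms(1-3) e, of p] * by simp
  qed
  then show ?thesis using assms(4) by (simp add: elem_equiv_def)
qed

lemma countable_group_copy:
  assumes "group L" "countable (carrier L)"
  shows "\<exists>(K :: nat monoid) h. group K \<and> h \<in> iso L K"
proof -
  interpret L: group L by fact
  define g where "g = to_nat_on (carrier L)"
  define g' where "g' = from_nat_into (carrier L)"
  have g'g: "g' (g x) = x" if "x \<in> carrier L" for x
    using that assms(2) by (simp add: g_def g'_def)
  define K :: "nat monoid" where
    "K = \<lparr>carrier = g ` carrier L, monoid.mult = (\<lambda>x y. g (g' x \<otimes>\<^bsub>L\<^esub> g' y)), monoid.one = g \<one>\<^bsub>L\<^esub>\<rparr>"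
  have "group K"
  proof (rule groupI)
    fix x assume "x \<in> carrier K"
    then obtain a where a: "a \<in> carrier L" "x = g a" by (auto simp: K_def)
    then show "\<exists>y\<in>carrier K. y \<otimes>\<^bsub>K\<^esub> x = \<one>\<^bsub>K\<^esub>"
      by (intro bexI[of _ "g (inv\<^bsub>L\<^esub> a)"]) (auto simp: K_def g'g)
  qed (auto simp: K_def g'g L.m_assoc)
  moreover have "g \<in> iso L K"
  proof (rule isoI)
    show "g \<in> hom L K" by (rule homI) (auto simp: K_def g'g)
    show "bij_betw g (carrier L) (carrier K)"
      using g'g by (auto simp: K_def bij_betw_def intro: inj_on_inverseI)
  qed
  ultimately show ?thesis by blast
qed

theorem theorem3p3:
  fixes d :: nat
    and C :: "'f::field mat set"
    and \<Gamma> :: "'f mat monoid"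
    and b :: "'f mat"
    and N :: "'f mat set"
  assumes "subgroup C (GL TYPE('f) d)"
    and "\<Gamma> = (GL TYPE('f) d)\<lparr>carrier := C\<rparr>"
    and "fin_gen \<Gamma>"
    and "prime_group TYPE(nat) \<Gamma>"
    and "brenner \<Gamma> b"
    and "finite (center \<Gamma>)"
    and "N \<lhd> \<Gamma>" and "finite N"
    and "\<And>M. M \<lhd> \<Gamma> \<Longrightarrow> finite M \<Longrightarrow> M \<subseteq> N"
    and "\<exists>k::nat. \<forall>H. subgroup H \<Gamma> \<and> H \<subseteq> center_centralizer \<Gamma> b \<and>
            fin_gen (\<Gamma>\<lparr>carrier := H\<rparr>) \<longrightarrow> min_gens (\<Gamma>\<lparr>carrier := H\<rparr>) \<le> k"
  shows "first_order_rigid TYPE('b) \<Gamma>"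
  unfolding first_order_rigid_def
proof (intro allI impI)
  fix L :: "'b monoid"
  assume "group L \<and> fin_gen L \<and> elem_equiv L \<Gamma>"
  then have L: "group L" "fin_gen L" "elem_equiv L \<Gamma>" by auto
  interpret linear_group d C \<Gamma> by (rule linear_group.intro[OF assms(1,2)])
  \<comment> \<open>Primeness is available for groups carried by \<open>nat\<close>, so
    \<open>L\<close> is replaced by a copy there.\<close>
  obtain K :: "nat monoid" and h where K: "group K" and h: "h \<in> iso L K"
    using countable_group_copy[OF L(1) countable_fin_gen[OF L(1,2)]] by blast
  have "elem_equiv K \<Gamma>" by (rule elem_equiv_iso[OF L(1) K h L(3)])
  then obtain f where f: "elem_embedding \<Gamma> K f"
    using assms(4) K unfolding prime_group_def by blast
  have "fin_gen K"
  proof -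
    interpret L: group L by (rule L(1))
    interpret K: group K by (rule K)
    interpret h: group_hom L K h using h by unfold_locales (simp add: iso_def)
    obtain S where S: "S \<subseteq> carrier L" "finite S" "generate L S = carrier L"
      using L(2) by (auto simp: fin_gen_def)
    have "h ` carrier L = carrier K" using h by (auto simp: iso_def bij_betw_def)
    then have "generate K (h ` S) = carrier K" using h.generate_img[OF S(1)] S(3) by simp
    then show ?thesis
      unfolding fin_gen_def using S(1,2) by (intro exI[of _ "h ` S"]) auto
  qed
  moreover obtain k where "\<forall>H. subgroup H \<Gamma> \<and> H \<subseteq> center_centralizer \<Gamma> b \<and>
      fin_gen (\<Gamma>\<lparr>carrier := H\<rparr>) \<longrightarrow> min_gens (\<Gamma>\<lparr>carrier := H\<rparr>) \<le> k"
    using assms(10) by blast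
  moreover have "N \<subseteq> carrier \<Gamma>" using assms(7) normal_imp_subgroup subgroup.subset by blast
  ultimately have "f ` carrier \<Gamma> = carrier K"
    using elem_embedding_onto[OF assms(3) K _ f assms(5,8) _ assms(9)] by blast
  then have "f \<in> iso \<Gamma> K"
    using elem_embedding_inj[OF f] f by (auto simp: iso_def bij_betw_def elem_embedding_def)
  then have "K \<cong> \<Gamma>" using iso_sym[of K] by (auto simp: is_iso_def)
  moreover have "L \<cong> K" using h by (auto simp: is_iso_def)
  ultimately show "L \<cong> \<Gamma>" using iso_trans by blast
qed

end
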